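(* Let $D=\mathbb T^2=\mathbb R^2/\mathbb Z^2$ be the flat torus with its Riemannian distance $\mathsf d$ and unit-mass volume measure $\mathfrak m$. Let $X_1,X_2,\dots,Y_1,Y_2,\dots$ be i.i.d. with law $\mathfrak m$, $\mu^n=\frac1n\sum_{i=1}^n\delta_{X_i}$ and $\nu^n=\frac1n\sum_{i=1}^n\delta_{Y_i}$. Then \[ \liminf_{n\to\infty}\sqrt{\frac{n}{\log n}}\;\mathbb E\left[W_1(\mu^n,\nu^n)\right]>0 . \] The same holds for the matching to the reference measure: \[ \liminf_{n\to\infty}\sqrt{\frac{n}{\log n}}\;\mathbb E\left[W_1(\mu^n,\mathfrak m)\right]>0 . \]
   Context: $W_1$ is the Wasserstein distance of order $1$: $W_1(\mu,\nu)=\min\int_{D\times D}\mathsf d(x,y)\,d\Sigma(x,y)$ over Borel probability measures $\Sigma$ on $D\times D$ with marginals $\mu$ and $\nu$. *)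

theory Defs
  imports "HOL-Probability.Probability"
begin

definition torus_rel :: "real^2 \<Rightarrow> real^2 \<Rightarrow> bool" where
  "torus_rel x y \<longleftrightarrow> (\<forall>i. x $ i - y $ i \<in> \<int>)"

lemma equivp_torus_rel: "equivp torus_rel"
proof (rule equivpI)
  show "reflp torus_rel" by (auto simp: reflp_def torus_rel_def)
  show "symp torus_rel"
    unfolding symp_def torus_rel_def by (metis Ints_minus minus_diff_eq)
  show "transp torus_rel"
  proof (rule transpI)
    fix x y z assume "torus_rel x y" "torus_rel y z"
    then have "(x $ i - y $ i) + (y $ i - z $ i) \<in> \<int>" for i
      unfolding torus_rel_def by (blast intro: Ints_add)
    then show "torus_rel x z" by (simp add: torus_rel_def)
  qed
qed

quotient_type torus = "real^2" / torus_rel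
  by (rule equivp_torus_rel)

definition torus_proj :: "real^2 \<Rightarrow> torus" where
  "torus_proj = abs_torus"

lemma torus_proj_eq_iff: "torus_proj x = torus_proj y \<longleftrightarrow> torus_rel x y"
  by (simp add: torus_proj_def torus.abs_eq_iff)

lemma torus_proj_surj: obtains x where "torus_proj x = s"
  by (metis Quotient3_abs_rep Quotient3_torus torus_proj_def)

text \<open>The Riemannian distance of the flat metric: every path in the torus lifts to the plane with
  the same length, so the infimum of the lengths of paths from \<open>s\<close> to \<open>t\<close> is the least Euclidean
  distance between representatives of \<open>s\<close> and \<open>t\<close>.\<close>

definition torus_dist :: "torus \<Rightarrow> torus \<Rightarrow> real" where
  "torus_dist s t = Inf {dist x y |x y. torus_proj x = s \<and> torus_proj y = t}"

definition torus_lattice :: "(real^2) set" where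
  "torus_lattice = {k. \<forall>i. k $ i \<in> \<int>}"

lemma torus_dist_proj:
  "torus_dist (torus_proj x) (torus_proj y) = infdist (x - y) torus_lattice"
proof -
  have "{dist x' y' |x' y'. torus_proj x' = torus_proj x \<and> torus_proj y' = torus_proj y}
      = {dist (x - y) k |k. k \<in> torus_lattice}" (is "?A = ?B")
  proof (intro equalityI subsetI)
    fix d assume "d \<in> ?A"
    then obtain x' y' where d: "d = dist x' y'"
      and x': "\<And>i. x' $ i - x $ i \<in> \<int>" and y': "\<And>i. y' $ i - y $ i \<in> \<int>"
      by (auto simp: torus_proj_eq_iff torus_rel_def)
    let ?k = "(y' - y) - (x' - x)"
    have "?k \<in> torus_lattice"
      using x' y' by (auto simp: torus_lattice_def intro!: Ints_diff[OF y' x'])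
    moreover have "dist x' y' = dist (x - y) ?k"
      by (simp add: dist_norm algebra_simps)
    ultimately show "d \<in> ?B" using d by blast
  next
    fix d assume "d \<in> ?B"
    then obtain k where k: "k \<in> torus_lattice" and d: "d = dist (x - y) k" by blast
    have "torus_proj (y + k) = torus_proj y"
      using k by (auto simp: torus_proj_eq_iff torus_rel_def torus_lattice_def)
    moreover have "d = dist x (y + k)"
      using d by (simp add: dist_norm algebra_simps)
    ultimately show "d \<in> ?A" by blast
  qed
  moreover have "torus_lattice \<noteq> {}"
    by (auto simp: torus_lattice_def intro!: exI[of _ 0])
  ultimately show ?thesis
    by (simp add: torus_dist_def infdist_def Setcompr_eq_image)
qed

lemma closed_torus_lattice: "closed torus_lattice"
proof -
  have "closed (\<Inter>i. (\<lambda>k::real^2. k $ i) -` (\<int>::real set))"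
    by (intro closed_INT ballI closed_vimage closed_Ints continuous_intros)
  also have "(\<Inter>i. (\<lambda>k::real^2. k $ i) -` \<int>) = torus_lattice"
    by (auto simp: torus_lattice_def)
  finally show ?thesis .
qed

lemma torus_lattice_nonempty: "torus_lattice \<noteq> {}"
  by (auto simp: torus_lattice_def intro!: exI[of _ 0])

lemma torus_lattice_minus: "k \<in> torus_lattice \<Longrightarrow> - k \<in> torus_lattice"
  by (auto simp: torus_lattice_def)

lemma torus_lattice_add: "k \<in> torus_lattice \<Longrightarrow> l \<in> torus_lattice \<Longrightarrow> k + l \<in> torus_lattice"
  by (auto simp: torus_lattice_def)

lemma torus_dist_attained:
  obtains k where "k \<in> torus_lattice"
    "torus_dist (torus_proj x) (torus_proj y) = norm (x - y - k)"
  by (metis torus_dist_proj infdist_attains_inf closed_torus_lattice torus_lattice_nonempty dist_norm)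

lemma torus_dist_le:
  "k \<in> torus_lattice \<Longrightarrow> torus_dist (torus_proj x) (torus_proj y) \<le> norm (x - y - k)"
  by (metis torus_dist_proj infdist_le dist_norm)

instantiation torus :: metric_space
begin

definition "dist_torus = torus_dist"

definition "uniformity_torus =
  (INF e\<in>{0<..}. principal {(s::torus, t). dist s t < e})"

definition "open_torus (U :: torus set) \<longleftrightarrow>
  (\<forall>s\<in>U. \<forall>\<^sub>F (s', t) in uniformity. s' = s \<longrightarrow> t \<in> U)"

instance
proof
  fix s t u :: torus
  obtain x y z where xyz: "s = torus_proj x" "t = torus_proj y" "u = torus_proj z"
    by (metis torus_proj_surj)
  show "dist s t = 0 \<longleftrightarrow> s = t"
  proof -
    have "infdist (x - y) torus_lattice = 0 \<longleftrightarrow> x - y \<in> torus_lattice"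
      using in_closed_iff_infdist_zero[OF closed_torus_lattice torus_lattice_nonempty] by blast
    then show ?thesis
      by (simp add: dist_torus_def xyz torus_dist_proj torus_proj_eq_iff torus_rel_def
          torus_lattice_def)
  qed
  show "dist s t \<le> dist s u + dist t u"
  proof -
    obtain k where k: "k \<in> torus_lattice" "dist s u = norm (x - z - k)"
      using torus_dist_attained[of x z] xyz by (auto simp: dist_torus_def)
    obtain l where l: "l \<in> torus_lattice" "dist t u = norm (y - z - l)"
      using torus_dist_attained[of y z] xyz by (auto simp: dist_torus_def)
    have "dist s t \<le> norm (x - y - (k + - l))"
      unfolding dist_torus_def xyz
      by (intro torus_dist_le torus_lattice_add torus_lattice_minus k l)
    also have "x - y - (k + - l) = (x - z - k) - (y - z - l)" by simp
    also have "norm \<dots> \<le> norm (x - z - k) + norm (y - z - l)" by (rule norm_triangle_ineq4)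
    finally show ?thesis using k l by simp
  qed
qed (simp_all add: uniformity_torus_def open_torus_def)

end

lemma dist_torus_proj_le: "dist (torus_proj x) (torus_proj y) \<le> dist x y"
  using torus_dist_le[of 0 x y] by (simp add: dist_torus_def dist_norm torus_lattice_def)

lemma continuous_on_torus_proj: "continuous_on A torus_proj"
  unfolding continuous_on_iff using dist_torus_proj_le le_less_trans by blast

lemma measurable_torus_proj [measurable]: "torus_proj \<in> borel_measurable borel"
  by (intro borel_measurable_continuous_onI continuous_on_torus_proj)

text \<open>\<open>cbox 0 1\<close> is the closed unit square, a fundamental domain up to a null set.\<close>

definition torus_measure :: "torus measure" where
  "torus_measure = distr (uniform_measure lborel (cbox 0 1)) borel torus_proj"

lemma prob_space_torus_measure: "prob_space torus_measure"
proof -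
  have "emeasure lborel (cbox 0 1 :: (real^2) set) = 1"
    by (subst emeasure_lborel_cbox)
      (auto simp: Basis_vec_def inner_axis prod.neutral)
  then show ?thesis
    unfolding torus_measure_def
    by (intro prob_space.prob_space_distr prob_space_uniform_measure) auto
qed

text \<open>The transport cost below is valued in \<^typ>\<open>ennreal\<close>, so that no integrability
  side condition is hidden in a default value. The infimum is over a nonempty set whenever
  \<open>\<mu>\<close> and \<open>\<nu>\<close> are Borel probability measures on a second-countable space (product coupling).\<close>

definition couplings ::
    "'a::topological_space measure \<Rightarrow> 'a measure \<Rightarrow> ('a \<times> 'a) measure set" where
  "couplings \<mu> \<nu> = {\<Sigma>. sets \<Sigma> = sets borel \<and> prob_space \<Sigma> \<and>
     distr \<Sigma> borel fst = \<mu> \<and> distr \<Sigma> borel snd = \<nu>}"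

definition W1 :: "'a::metric_space measure \<Rightarrow> 'a measure \<Rightarrow> ennreal" where
  "W1 \<mu> \<nu> = (INF \<Sigma>\<in>couplings \<mu> \<nu>. \<integral>\<^sup>+ p. ennreal (dist (fst p) (snd p)) \<partial>\<Sigma>)"

definition empirical_measure :: "nat \<Rightarrow> (nat \<Rightarrow> 'a::topological_space) \<Rightarrow> 'a measure" where
  "empirical_measure n x = measure_of UNIV (sets borel)
     (\<lambda>A. ennreal (1 / real n) * (\<Sum>i<n. emeasure (return borel (x i)) A))"

lemma sets_empirical_measure [simp, measurable_cong]: "sets (empirical_measure n x) = sets borel"
  unfolding empirical_measure_def by (metis sets.sets_measure_of_eq space_borel)

text \<open>The set function above is countably additive, so \<^const>\<open>measure_of\<close> does not collapse to zero.\<close>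

lemma emeasure_empirical_measure:
  assumes "A \<in> sets borel"
  shows "emeasure (empirical_measure n x) A =
    ennreal (1 / real n) * (\<Sum>i<n. emeasure (return borel (x i)) A)"
  using empirical_measure_def
proof (rule emeasure_measure_of)
  show "countably_additive (sets (empirical_measure n x))
      (\<lambda>A. ennreal (1 / real n) * (\<Sum>i<n. emeasure (return borel (x i)) A))"
  proof (rule countably_additiveI)
    fix F :: "nat \<Rightarrow> 'a set"
    assume F: "range F \<subseteq> sets (empirical_measure n x)" "disjoint_family F"
    then have "(\<Sum>j. emeasure (return borel (x i)) (F j)) = emeasure (return borel (x i)) (\<Union>j. F j)" for i
      by (intro suminf_emeasure) auto
    then show "(\<Sum>j. ennreal (1 / real n) * (\<Sum>i<n. emeasure (return borel (x i)) (F j))) =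
        ennreal (1 / real n) * (\<Sum>i<n. emeasure (return borel (x i)) (\<Union>j. F j))"
      by (simp add: suminf_sum[symmetric] suminf_sum)
  qed
qed (use assms in \<open>auto simp: positive_def\<close>)

end

theory Submission
  imports Defs
begin

text \<open>
  By duality, \<open>W1 \<mu> \<nu>\<close> is bounded below by testing against a Lipschitz function adapted to the sample.
  The test function is a multiscale sum \<open>f = \<Sum>\<^sub>Q z\<^sub>Q 2\<^bsup>-k(Q)\<^esup> \<psi>\<^sub>Q\<close> over dyadic squares \<open>Q\<close> of side at least
  about \<open>n\<^bsup>-1/4\<^esup>\<close>, where \<open>\<psi>\<^sub>Q\<close> is a product of tents supported in \<open>Q\<close> and \<open>z\<^sub>Q\<close> is the sign of the
  discrepancy \<open>D\<^sub>Q\<close> of \<open>\<psi>\<^sub>Q\<close>, except that \<open>z\<^sub>Q = 0\<close> whenever the gradient of the coarser terms, averaged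
  over \<open>Q\<close>, exceeds \<open>\<lambda>\<close> of order \<open>sqrt K\<close>, with \<open>K\<close> of order \<open>log n\<close> the number of scales.
  Stopping makes \<open>f\<close> Lipschitz with constant of order \<open>\<lambda>\<close>. The averaged gradients form a martingale
  along the dyadic squares with bounded increments, whatever the signs are, so by orthogonality
  the proportion of stopped squares at each scale is at most \<open>K / (4 \<lambda>\<^sup>2)\<close>, deterministically. Hence
  stopping costs only a small part of \<open>\<Sum>\<^sub>Q 2\<^bsup>-k(Q)\<^esup> \<bar>D\<^sub>Q\<bar>\<close>, whose expectation each scale increases
  by an amount of order \<open>1 / sqrt n\<close>. No independence between different squares is needed, only
  the second and fourth moments of each \<open>D\<^sub>Q\<close>. Altogether the expected distance is at least of
  order \<open>K / (\<lambda> sqrt n)\<close>, that is \<open>sqrt (log n / n)\<close>.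
\<close>

subsection \<open>Multiscale tent potentials\<close>

text \<open>The distance from \<open>u\<close> to the nearest integer.\<close>

definition tent :: "real \<Rightarrow> real" where
  "tent u = min (frac u) (1 - frac u)"

lemma tent_nonneg: "0 \<le> tent u"
  unfolding tent_def using frac_ge_0[of u] frac_lt_1[of u] by linarith

lemma tent_le_half: "tent u \<le> 1 / 2"
  unfolding tent_def by linarith

lemma tent_add_int: "tent (u + of_int m) = tent u"
  unfolding tent_def by (simp add: frac_def)

lemma tent_of_int [simp]: "tent (of_int m) = 0"
  by (simp add: tent_def)

text \<open>The slope of \<open>tent\<close> on the interval from \<open>m / 2\<close> to
  \<open>(m + 1) / 2\<close>.\<close>

definition sg :: "int \<Rightarrow> real" where
  "sg m = (if even m then 1 else -1)"

lemma abs_sg [simp]: "\<bar>sg m\<bar> = 1"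
  by (simp add: sg_def)

text \<open>The weight \<open>w \<lfloor>u\<rfloor>\<close> jumps only at integers, where the tent
  vanishes. So the formula extends to the closed half cell, although for odd \<open>m\<close> the
  floor at its right end already belongs to the next cell.\<close>

lemma tent_half_cell:
  assumes "of_int m / 2 \<le> u" "u \<le> (of_int m + 1) / 2"
  shows "w \<lfloor>u\<rfloor> * tent u =
    w (m div 2) * (if even m then u - of_int (m div 2) else of_int (m div 2) + 1 - u)"
proof (cases "even m")
  case True
  then obtain q where q: "m = 2 * q" by blast
  then have "\<lfloor>u\<rfloor> = q" using assms by (simp add: floor_eq_iff)
  then show ?thesis using assms q by (auto simp: tent_def frac_def)
next
  case False
  then obtain q where q: "m = 2 * q + 1" by (metis oddE)
  then have d: "m div 2 = q" by simp
  show ?thesis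
  proof (cases "u = of_int (q + 1)")
    case True
    then have "tent u = 0" by (metis tent_of_int)
    then show ?thesis using True False d by simp
  next
    case ne: False
    then have "\<lfloor>u\<rfloor> = q" using assms q by (simp add: floor_eq_iff)
    then show ?thesis using assms q False d by (auto simp: tent_def frac_def)
  qed
qed

lemma tent_half_cell_diff:
  assumes "of_int m / 2 \<le> u" "u \<le> (of_int m + 1) / 2"
    "of_int m / 2 \<le> v" "v \<le> (of_int m + 1) / 2"
  shows "w \<lfloor>v\<rfloor> * tent v - w \<lfloor>u\<rfloor> * tent u = w (m div 2) * sg m * (v - u)"
  unfolding tent_half_cell[OF assms(1,2)] tent_half_cell[OF assms(3,4)]
  by (simp add: sg_def algebra_simps)

section \<open>Dyadic cells and the bilinear structure of the potential\<close>

definition cell :: "nat \<Rightarrow> int \<Rightarrow> real set" where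
  "cell k i = {of_int i / 2 ^ k .. (of_int i + 1) / 2 ^ k}"

lemma cell_Suc_half:
  assumes "x \<in> cell (Suc k) i"
  shows "of_int i / 2 \<le> 2 ^ k * x" "2 ^ k * x \<le> (of_int i + 1) / 2"
  using assms by (auto simp: cell_def field_simps)

lemma cell_Suc_subset: "cell (Suc k) i \<subseteq> cell k (i div 2)"
proof
  fix x assume x: "x \<in> cell (Suc k) i"
  have "real_of_int (2 * (i div 2)) \<le> of_int i" "real_of_int (i + 1) \<le> of_int (2 * (i div 2) + 2)"
    unfolding of_int_le_iff by presburger+
  then have "of_int (i div 2) \<le> 2 ^ k * x" "2 ^ k * x \<le> of_int (i div 2) + 1"
    using cell_Suc_half[OF x] by (simp_all del: of_int_le_iff)
  then show "x \<in> cell k (i div 2)"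
    by (simp add: cell_def field_simps)
qed

lemma cell_floor: "x \<in> cell k \<lfloor>2 ^ k * x\<rfloor>"
  using of_int_floor_le[of "2 ^ k * x"] real_of_int_floor_add_one_ge[of "2 ^ k * x"]
  by (simp add: cell_def field_simps)

type_synonym coeffs = "nat \<Rightarrow> int \<Rightarrow> int \<Rightarrow> real"

text \<open>Dividing by \<open>2 ^ k\<close> compensates the slope \<open>2 ^ k\<close> of the
  rescaled tent, so with coefficients in [-1, 1] every level contributes to the gradient at the same
  order.\<close>

definition pot :: "coeffs \<Rightarrow> nat \<Rightarrow> real \<Rightarrow> real \<Rightarrow> real" where
  "pot z K x y = (\<Sum>k<K. z k \<lfloor>2 ^ k * x\<rfloor> \<lfloor>2 ^ k * y\<rfloor> * tent (2 ^ k * x) * tent (2 ^ k * y) / 2 ^ k)"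

text \<open>On the cells of level \<open>K\<close> the potential is bilinear: \<open>slope z K i y\<close> is its derivative in
  \<open>x\<close> on the \<open>i\<close>-th column, \<open>twist z K i j\<close> its mixed second derivative on the \<open>(i, j)\<close>-th cell.\<close>

primrec slope :: "coeffs \<Rightarrow> nat \<Rightarrow> int \<Rightarrow> real \<Rightarrow> real" where
  "slope z 0 i y = 0"
| "slope z (Suc k) i y =
    slope z k (i div 2) y + z k (i div 2) \<lfloor>2 ^ k * y\<rfloor> * sg i * tent (2 ^ k * y)"

primrec twist :: "coeffs \<Rightarrow> nat \<Rightarrow> int \<Rightarrow> int \<Rightarrow> real" where
  "twist z 0 i j = 0"
| "twist z (Suc k) i j =
    twist z k (i div 2) (j div 2) + z k (i div 2) (j div 2) * sg i * sg j * 2 ^ k"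

text \<open>A cell of level \<open>k + 1\<close> is half a period of the tent of level
  \<open>k\<close>, on which that tent is affine. Induction over the levels adds up the
  slopes.\<close>

lemma pot_diff:
  assumes "x \<in> cell K i" "x' \<in> cell K i"
  shows "pot z K x' y - pot z K x y = slope z K i y * (x' - x)"
  using assms
proof (induction K arbitrary: i)
  case 0
  then show ?case by (simp add: pot_def)
next
  case (Suc K)
  let ?w = "\<lambda>m. z K m \<lfloor>2 ^ K * y\<rfloor>"
  have step: "?w \<lfloor>2 ^ K * x'\<rfloor> * tent (2 ^ K * x') - ?w \<lfloor>2 ^ K * x\<rfloor> * tent (2 ^ K * x)
      = ?w (i div 2) * sg i * (2 ^ K * x' - 2 ^ K * x)"
    by (intro tent_half_cell_diff cell_Suc_half Suc.prems)
  have IH: "pot z K x' y - pot z K x y = slope z K (i div 2) y * (x' - x)"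
    using Suc.IH[of "i div 2"] cell_Suc_subset Suc.prems by blast
  have "pot z (Suc K) x' y - pot z (Suc K) x y = (pot z K x' y - pot z K x y)
      + (?w \<lfloor>2 ^ K * x'\<rfloor> * tent (2 ^ K * x') - ?w \<lfloor>2 ^ K * x\<rfloor> * tent (2 ^ K * x)) * tent (2 ^ K * y) / 2 ^ K"
    by (simp add: pot_def left_diff_distrib diff_divide_distrib)
  also have "\<dots> = slope z (Suc K) i y * (x' - x)"
    unfolding step IH by (simp add: field_simps)
  finally show ?case .
qed

lemma slope_diff:
  assumes "y \<in> cell K j" "y' \<in> cell K j"
  shows "slope z K i y' - slope z K i y = twist z K i j * (y' - y)"
  using assms
proof (induction K arbitrary: i j)
  case 0
  then show ?case by simp
next
  case (Suc K)
  let ?w = "\<lambda>m. z K (i div 2) m"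
  have step: "?w \<lfloor>2 ^ K * y'\<rfloor> * tent (2 ^ K * y') - ?w \<lfloor>2 ^ K * y\<rfloor> * tent (2 ^ K * y)
      = ?w (j div 2) * sg j * (2 ^ K * y' - 2 ^ K * y)"
    by (intro tent_half_cell_diff cell_Suc_half Suc.prems)
  have IH: "slope z K (i div 2) y' - slope z K (i div 2) y = twist z K (i div 2) (j div 2) * (y' - y)"
    using Suc.IH[of "j div 2" "i div 2"] cell_Suc_subset Suc.prems by blast
  have "slope z (Suc K) i y' - slope z (Suc K) i y = (slope z K (i div 2) y' - slope z K (i div 2) y)
      + (?w \<lfloor>2 ^ K * y'\<rfloor> * tent (2 ^ K * y') - ?w \<lfloor>2 ^ K * y\<rfloor> * tent (2 ^ K * y)) * sg i"
    by (simp add: field_simps)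
  then show ?case unfolding step IH by (simp add: field_simps)
qed

definition bounded_coeffs :: "coeffs \<Rightarrow> bool" where
  "bounded_coeffs z \<longleftrightarrow> (\<forall>k i j. \<bar>z k i j\<bar> \<le> 1)"

lemma bounded_coeffsD: "bounded_coeffs z \<Longrightarrow> \<bar>z k i j\<bar> \<le> 1"
  by (simp add: bounded_coeffs_def)

text \<open>Geometric series: level \<open>l\<close> contributes at most
  \<open>2 ^ l\<close>.\<close>

lemma abs_twist_le:
  assumes "bounded_coeffs z"
  shows "\<bar>twist z k i j\<bar> \<le> 2 ^ k"
proof (induction k arbitrary: i j)
  case (Suc k)
  have "\<bar>z k (i div 2) (j div 2) * sg i * sg j * 2 ^ k\<bar> \<le> 2 ^ k"
    using bounded_coeffsD[OF assms] by (simp add: abs_mult)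
  from add_mono[OF Suc this] have
    "\<bar>twist z k (i div 2) (j div 2)\<bar> + \<bar>z k (i div 2) (j div 2) * sg i * sg j * 2 ^ k\<bar> \<le> 2 ^ Suc k"
    by simp
  with abs_triangle_ineq show ?case unfolding twist.simps by (rule order_trans)
qed simp

section \<open>Averaged gradients as a martingale along dyadic squares\<close>

definition centre :: "nat \<Rightarrow> int \<Rightarrow> real" where
  "centre k j = (of_int j + 1 / 2) / 2 ^ k"

text \<open>By \<open>slope_diff\<close> the slope is affine in \<open>y\<close> on a cell, so its
  value at the centre is its average over the square.\<close>

definition mean_slope :: "coeffs \<Rightarrow> nat \<Rightarrow> int \<Rightarrow> int \<Rightarrow> real" where
  "mean_slope z k i j = slope z k i (centre k j)"

lemma centre_in_cell: "centre k j \<in> cell k j"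
  by (simp add: centre_def cell_def field_simps)

text \<open>The slope varies at rate at most \<open>2 ^ k\<close>, and a point of the cell is at
  distance at most half a cell length from the centre.\<close>

lemma slope_near_mean_slope:
  assumes "bounded_coeffs z" "y \<in> cell k j"
  shows "\<bar>slope z k i y - mean_slope z k i j\<bar> \<le> 1 / 2"
proof -
  have "\<bar>slope z k i y - mean_slope z k i j\<bar> = \<bar>twist z k i j\<bar> * \<bar>y - centre k j\<bar>"
    unfolding mean_slope_def using slope_diff[OF centre_in_cell assms(2)] by (simp add: abs_mult)
  also have "\<dots> \<le> 2 ^ k * (1 / 2 / 2 ^ k)"
  proof (intro mult_mono abs_twist_le assms)
    have le: "\<bar>2 ^ k * y - (of_int j + 1 / 2)\<bar> \<le> 1 / 2"
      using assms(2) by (auto simp: cell_def field_simps abs_le_iff)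
    have "y - centre k j = (2 ^ k * y - (of_int j + 1 / 2)) / 2 ^ k"
      by (simp add: centre_def diff_divide_distrib)
    then have "\<bar>y - centre k j\<bar> = \<bar>2 ^ k * y - (of_int j + 1 / 2)\<bar> / 2 ^ k"
      by (simp only: abs_divide) simp
    with divide_right_mono[OF le, of "2 ^ k"] show "\<bar>y - centre k j\<bar> \<le> 1 / 2 / 2 ^ k"
      by simp
  qed auto
  finally show ?thesis by simp
qed

text \<open>The corrections of the four children sum to zero, which is the martingale property of the
  averaged gradient.\<close>

lemma mean_slope_child:
  fixes e f :: int
  assumes "e \<in> {0, 1}" "f \<in> {0, 1}"
  shows "mean_slope z (Suc k) (2 * i + e) (2 * j + f) =
    mean_slope z k i j - twist z k i j * sg f / (4 * 2 ^ k) + z k i j * sg e / 4"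
proof -
  let ?y = "centre (Suc k) (2 * j + f)"
  have u: "2 ^ k * ?y = of_int j + of_int f / 2 + 1 / 4"
    by (simp add: centre_def field_simps)
  have fl: "\<lfloor>2 ^ k * ?y\<rfloor> = j"
    unfolding u using assms(2) by (auto simp: floor_eq_iff)
  \<comment> \<open>The centre of a child lies a quarter of the parent's length from one of the
    parent's ends.\<close>
  have t: "tent (2 ^ k * ?y) = 1 / 4"
    using fl assms(2) unfolding tent_def frac_def by (auto simp: u)
  have in_cell: "?y \<in> cell k j"
    using cell_floor[of ?y k] fl by simp
  have "?y - centre k j = - sg f / (4 * 2 ^ k)"
    using assms(2) by (auto simp: centre_def sg_def field_simps)
  then have "slope z k i ?y = mean_slope z k i j + twist z k i j * (- sg f / (4 * 2 ^ k))"
    using slope_diff[OF centre_in_cell in_cell, of z i] by (simp add: mean_slope_def)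
  moreover have "(2 * i + e) div 2 = i" "sg (2 * i + e) = sg e"
    using assms(1) by (auto simp: sg_def)
  ultimately show ?thesis
    unfolding mean_slope_def[of z "Suc k"] by (simp add: fl t)
qed

lemma sum_int_double:
  fixes g :: "int \<Rightarrow> 'b::comm_monoid_add"
  shows "(\<Sum>i\<in>{0..<2 * int n}. g i) = (\<Sum>i\<in>{0..<int n}. g (2 * i) + g (2 * i + 1))"
proof (induction n)
  case (Suc n)
  have "{0..<2 * int (Suc n)} = insert (2 * int n) (insert (2 * int n + 1) {0..<2 * int n})"
    "{0..<int (Suc n)} = insert (int n) {0..<int n}"
    by auto
  then show ?case using Suc by (simp add: ac_simps)
qed simp

lemma sum_dyadic_Suc:
  fixes g :: "int \<Rightarrow> 'b::comm_monoid_add"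
  shows "(\<Sum>i\<in>{0..<2 ^ Suc k}. g i) = (\<Sum>i\<in>{0..<2 ^ k}. g (2 * i) + g (2 * i + 1))"
  using sum_int_double[of g "2 ^ k"] by simp

text \<open>Orthogonality of martingale increments: over the four children the cross terms cancel,
  and both corrections are at most 1/4 in modulus. Hence each level raises the mean square by at
  most 2/16 = 1/8.\<close>

lemma sum_mean_slope_sq:
  assumes "bounded_coeffs z"
  shows "(\<Sum>i\<in>{0..<2 ^ k}. \<Sum>j\<in>{0..<2 ^ k}. (mean_slope z k i j)\<^sup>2) \<le> 4 ^ k * real k / 8"
proof (induction k)
  case 0
  then show ?case by (simp add: mean_slope_def)
next
  case (Suc k)
  let ?m = "mean_slope z (Suc k)"
  have quad: "(?m (2 * i) (2 * j))\<^sup>2 + (?m (2 * i) (2 * j + 1))\<^sup>2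
      + ((?m (2 * i + 1) (2 * j))\<^sup>2 + (?m (2 * i + 1) (2 * j + 1))\<^sup>2)
      \<le> 4 * (mean_slope z k i j)\<^sup>2 + 1 / 2" for i j
  proof -
    define a p q where "a = mean_slope z k i j" "p = twist z k i j / (4 * 2 ^ k)" "q = z k i j / 4"
    note apq = this
    have "\<bar>p\<bar> \<le> 1 / 4" "\<bar>q\<bar> \<le> 1 / 4"
      using abs_twist_le[OF assms, of k i j] bounded_coeffsD[OF assms, of k i j]
      by (simp_all add: apq field_simps)
    then have "p\<^sup>2 \<le> 1 / 16" "q\<^sup>2 \<le> 1 / 16"
      using power_mono[of "\<bar>p\<bar>" "1 / 4" 2] power_mono[of "\<bar>q\<bar>" "1 / 4" 2]
      by (simp_all add: power2_eq_square)
    moreover have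
      "?m (2 * i) (2 * j) = a - p + q" "?m (2 * i) (2 * j + 1) = a + p + q"
      "?m (2 * i + 1) (2 * j) = a - p - q" "?m (2 * i + 1) (2 * j + 1) = a + p - q"
      using mean_slope_child[of 0 0 z k i j] mean_slope_child[of 0 1 z k i j]
        mean_slope_child[of 1 0 z k i j] mean_slope_child[of 1 1 z k i j]
      by (simp_all add: apq sg_def)
    ultimately show ?thesis
      unfolding apq(1)[symmetric] by (simp only:) (simp add: power2_eq_square algebra_simps)
  qed
  have "(\<Sum>i\<in>{0..<2 ^ Suc k}. \<Sum>j\<in>{0..<2 ^ Suc k}. (?m i j)\<^sup>2) =
      (\<Sum>i\<in>{0..<2 ^ k}. \<Sum>j\<in>{0..<2 ^ k}. (?m (2 * i) (2 * j))\<^sup>2 + (?m (2 * i) (2 * j + 1))\<^sup>2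
      + ((?m (2 * i + 1) (2 * j))\<^sup>2 + (?m (2 * i + 1) (2 * j + 1))\<^sup>2))"
    by (simp only: sum_dyadic_Suc sum.distrib)
  also have "\<dots> \<le> (\<Sum>i\<in>{0..<2 ^ k}. \<Sum>j\<in>{0..<2 ^ k}. 4 * (mean_slope z k i j)\<^sup>2 + 1 / 2)"
    by (intro sum_mono quad)
  also have "\<dots> = 4 * (\<Sum>i\<in>{0..<2 ^ k}. \<Sum>j\<in>{0..<2 ^ k}. (mean_slope z k i j)\<^sup>2) + 4 ^ k / 2"
    by (simp add: sum.distrib sum_distrib_left flip: power_mult_distrib)
  also have "\<dots> \<le> 4 * (4 ^ k * real k / 8) + 4 ^ k / 2"
    using Suc by linarith
  finally show ?case by (simp add: algebra_simps)
qed

section \<open>Lipschitz bounds and descent to the torus\<close>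

lemma lipschitz_from_cells:
  fixes g :: "real \<Rightarrow> real"
  assumes "\<And>i x x'. x \<in> cell k i \<Longrightarrow> x' \<in> cell k i \<Longrightarrow> \<bar>g x' - g x\<bar> \<le> L * \<bar>x' - x\<bar>"
  shows "\<bar>g x' - g x\<bar> \<le> L * \<bar>x' - x\<bar>"
proof -
  have "\<bar>g x' - g x\<bar> \<le> L * \<bar>x' - x\<bar>" if "x \<le> x'" for x x'
    using that
  proof (induction "nat (\<lfloor>2 ^ k * x'\<rfloor> - \<lfloor>2 ^ k * x\<rfloor>)" arbitrary: x)
    case 0
    have "\<lfloor>2 ^ k * x\<rfloor> \<le> \<lfloor>2 ^ k * x'\<rfloor>" using 0 by (intro floor_mono) simp
    then have "\<lfloor>2 ^ k * x\<rfloor> = \<lfloor>2 ^ k * x'\<rfloor>" using 0 by simp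
    then show ?case using assms cell_floor by metis
  next
    case (Suc n)
    \<comment> \<open>The right end of the cell of \<open>x\<close>. Cells are closed, so
      \<open>m\<close> still lies in this cell, while its floor already counts it to the next one;
      the number of boundaries left to cross drops by one.\<close>
    define m :: real where "m = of_int (\<lfloor>2 ^ k * x\<rfloor> + 1) / 2 ^ k"
    have fm: "\<lfloor>2 ^ k * m\<rfloor> = \<lfloor>2 ^ k * x\<rfloor> + 1" by (simp add: m_def)
    have "\<lfloor>2 ^ k * x\<rfloor> + 1 \<le> \<lfloor>2 ^ k * x'\<rfloor>" using Suc by linarith
    then have "of_int (\<lfloor>2 ^ k * x\<rfloor> + 1) \<le> 2 ^ k * x'" by linarith
    then have mx': "m \<le> x'" by (simp add: m_def field_simps)
    have m: "m \<in> cell k \<lfloor>2 ^ k * x\<rfloor>" by (simp add: m_def cell_def field_simps)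
    have xm: "x \<le> m"
      using cell_floor[of x k] by (simp add: m_def cell_def field_simps)
    have "\<bar>g x' - g m\<bar> \<le> L * \<bar>x' - m\<bar>"
      using Suc.hyps mx' fm by (intro Suc.hyps(1)) auto
    moreover have "\<bar>g m - g x\<bar> \<le> L * \<bar>m - x\<bar>"
      by (rule assms[OF cell_floor m])
    moreover have "L * \<bar>x' - x\<bar> = L * \<bar>x' - m\<bar> + L * \<bar>m - x\<bar>"
      using xm mx' by (simp add: algebra_simps)
    ultimately show ?case by linarith
  qed
  from this[of x x'] this[of x' x] show ?thesis
    by (cases "x \<le> x'") (simp_all add: abs_minus_commute)
qed

text \<open>Exchanging the coordinates turns statements about \<open>x\<close>-slopes into statements about
  \<open>y\<close>-slopes.\<close>

definition swap :: "coeffs \<Rightarrow> coeffs" where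
  "swap z k i j = z k j i"

lemma pot_swap: "pot (swap z) K y x = pot z K x y"
  by (simp add: pot_def swap_def mult.commute mult.left_commute)

lemma bounded_coeffs_swap: "bounded_coeffs z \<Longrightarrow> bounded_coeffs (swap z)"
  by (simp add: bounded_coeffs_def swap_def)

lemma pot_lipschitz:
  assumes "\<And>i y. \<bar>slope z K i y\<bar> \<le> L" "\<And>i y. \<bar>slope (swap z) K i y\<bar> \<le> L"
  shows "\<bar>pot z K x' y' - pot z K x y\<bar> \<le> L * (\<bar>x' - x\<bar> + \<bar>y' - y\<bar>)"
proof -
  have 1: "\<bar>pot w K x' y - pot w K x y\<bar> \<le> L * \<bar>x' - x\<bar>"
    if "\<And>i y. \<bar>slope w K i y\<bar> \<le> L" for w x x' y
    by (rule lipschitz_from_cells[where k = K])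
       (simp add: pot_diff abs_mult mult_right_mono that)
  show ?thesis
    using 1[of z x' y' x] 1[of "swap z" y' x y] assms
    by (simp add: pot_swap algebra_simps)
qed

text \<open>Translation by an integer moves indices of level \<open>k\<close> by multiples of
  \<open>2 ^ k\<close>; this is the invariance that lets the potential descend to the torus.\<close>

definition periodic_coeffs :: "coeffs \<Rightarrow> bool" where
  "periodic_coeffs z \<longleftrightarrow> (\<forall>k i j a b. z k (i + a * 2 ^ k) (j + b * 2 ^ k) = z k i j)"

lemma floor_dyadic_shift: "\<lfloor>2 ^ k * (x + of_int a)\<rfloor> = \<lfloor>2 ^ k * x\<rfloor> + a * 2 ^ k"
proof -
  have "2 ^ k * (x + of_int a) = 2 ^ k * x + of_int (a * 2 ^ k)" by (simp add: algebra_simps)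
  then show ?thesis by (metis floor_add_int)
qed

lemma tent_dyadic_shift: "tent (2 ^ k * (x + of_int a)) = tent (2 ^ k * x)"
proof -
  have "2 ^ k * (x + of_int a) = 2 ^ k * x + of_int (a * 2 ^ k)" by (simp add: algebra_simps)
  then show ?thesis by (metis tent_add_int)
qed

lemma pot_periodic:
  assumes "periodic_coeffs z"
  shows "pot z K (x + of_int a) (y + of_int b) = pot z K x y"
  using assms by (simp add: pot_def periodic_coeffs_def floor_dyadic_shift tent_dyadic_shift)

definition torus_fun :: "coeffs \<Rightarrow> nat \<Rightarrow> torus \<Rightarrow> real" where
  "torus_fun z K t = pot z K (rep_torus t $ 1) (rep_torus t $ 2)"

lemma torus_fun_proj:
  assumes "periodic_coeffs z"
  shows "torus_fun z K (torus_proj x) = pot z K (x $ 1) (x $ 2)"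
proof -
  have "torus_rel (rep_torus (torus_proj x)) x"
    by (metis Quotient3_abs_rep Quotient3_torus torus_proj_def torus_proj_eq_iff)
  then obtain a b where "rep_torus (torus_proj x) $ 1 - x $ 1 = of_int a"
    "rep_torus (torus_proj x) $ 2 - x $ 2 = of_int b"
    unfolding torus_rel_def by (meson Ints_cases)
  then have "rep_torus (torus_proj x) $ 1 = x $ 1 + of_int a"
    "rep_torus (torus_proj x) $ 2 = x $ 2 + of_int b"
    by linarith+
  then show ?thesis by (simp add: torus_fun_def pot_periodic[OF assms])
qed

lemma torus_fun_lipschitz:
  assumes "periodic_coeffs z" "0 \<le> L"
    and "\<And>i y. \<bar>slope z K i y\<bar> \<le> L" "\<And>i y. \<bar>slope (swap z) K i y\<bar> \<le> L"
  shows "\<bar>torus_fun z K s - torus_fun z K t\<bar> \<le> 2 * L * dist s t"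
proof -
  obtain x y where xy: "s = torus_proj x" "t = torus_proj y" by (metis torus_proj_surj)
  obtain k where k: "k \<in> torus_lattice" "dist s t = norm (x - y - k)"
    using torus_dist_attained[of x y] xy by (auto simp: dist_torus_def)
  obtain a b where ab: "k $ 1 = of_int a" "k $ 2 = of_int b"
    using k(1) unfolding torus_lattice_def by (metis (mono_tags) Ints_cases mem_Collect_eq)
  have "torus_fun z K t = pot z K (y $ 1 + of_int a) (y $ 2 + of_int b)"
    unfolding xy by (simp add: torus_fun_proj pot_periodic assms)
  then have "\<bar>torus_fun z K s - torus_fun z K t\<bar>
      \<le> L * (\<bar>x $ 1 - (y $ 1 + of_int a)\<bar> + \<bar>x $ 2 - (y $ 2 + of_int b)\<bar>)"
    unfolding xy using pot_lipschitz[OF assms(3,4)] by (simp add: torus_fun_proj assms)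
  also have "\<dots> = L * (\<bar>(x - y - k) $ 1\<bar> + \<bar>(x - y - k) $ 2\<bar>)"
    by (simp add: ab algebra_simps)
  \<comment> \<open>Each coordinate is at most the Euclidean norm, whence the factor 2.\<close>
  also have "\<dots> \<le> L * (norm (x - y - k) + norm (x - y - k))"
    by (intro mult_left_mono add_mono component_le_norm_cart assms)
  finally show ?thesis using k by simp
qed

subsection \<open>Test functions on the torus and stopping\<close>

lemma abs_tent_increment_le:
  assumes "bounded_coeffs z"
  shows "\<bar>z k m n * sg i * tent u\<bar> \<le> 1 / 2"
proof -
  have "\<bar>z k m n\<bar> * \<bar>tent u\<bar> \<le> 1 * (1 / 2)"
    using tent_le_half[of u] tent_nonneg[of u] bounded_coeffsD[OF assms]
    by (intro mult_mono) auto
  then show ?thesis by (simp add: abs_mult)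
qed

text \<open>A crude bound that serves continuity, hence measurability; the quantitative Lipschitz
  bound comes from stopping.\<close>

lemma abs_slope_le:
  assumes "bounded_coeffs z"
  shows "\<bar>slope z K i y\<bar> \<le> real K"
proof (induction K arbitrary: i)
  case (Suc K)
  have "\<bar>z K (i div 2) \<lfloor>2 ^ K * y\<rfloor> * sg i * tent (2 ^ K * y)\<bar> \<le> 1 / 2"
    by (rule abs_tent_increment_le[OF assms])
  with Suc[of "i div 2"] show ?case unfolding slope.simps of_nat_Suc by linarith
qed simp

lemma torus_fun_continuous:
  assumes "periodic_coeffs z" "bounded_coeffs z"
  shows "continuous_on UNIV (torus_fun z K)"
proof -
  have "(2 * real K)-lipschitz_on UNIV (torus_fun z K)"
    using torus_fun_lipschitz[OF assms(1), of "real K" K] abs_slope_le assms(2) bounded_coeffs_swap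
    by (intro lipschitz_onI) (auto simp: dist_real_def)
  then show ?thesis by (rule lipschitz_on_continuous_on)
qed

lemma abs_torus_fun_le:
  assumes "bounded_coeffs z"
  shows "\<bar>torus_fun z K t\<bar> \<le> real K"
proof -
  have "\<bar>z k m n * tent u * tent v / 2 ^ k\<bar> \<le> 1" for k m n u v
  proof -
    have "\<bar>z k m n\<bar> * \<bar>tent u\<bar> * \<bar>tent v\<bar> \<le> 1 * (1 / 2) * (1 / 2)"
      using tent_le_half tent_nonneg bounded_coeffsD[OF assms]
      by (intro mult_mono) auto
    also have "\<dots> \<le> 2 ^ k"
      by (rule order_trans[OF _ one_le_power]) auto
    finally show ?thesis by (simp add: abs_mult)
  qed
  then have "\<bar>torus_fun z K t\<bar> \<le> (\<Sum>k<K. 1)"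
    unfolding torus_fun_def pot_def by (intro order_trans[OF sum_abs] sum_mono)
  then show ?thesis by simp
qed

section \<open>The bump of a single dyadic square\<close>

definition tent_cell :: "nat \<Rightarrow> int \<Rightarrow> real \<Rightarrow> real" where
  "tent_cell k i u = of_bool (\<lfloor>2 ^ k * u\<rfloor> mod 2 ^ k = i) * tent (2 ^ k * u)"

definition bump :: "nat \<Rightarrow> int \<Rightarrow> int \<Rightarrow> torus \<Rightarrow> real" where
  "bump k i j t = tent_cell k i (rep_torus t $ 1) * tent_cell k j (rep_torus t $ 2)"

text \<open>A bump is a potential whose coefficients vanish except on one square and its integer
  translates; it thereby inherits continuity and independence of the representative.\<close>

lemma bump_eq_torus_fun:
  obtains z where "periodic_coeffs z" "bounded_coeffs z" "\<And>x y. tent_cell k i x * tent_cell k j y = 2 ^ k * pot z (Suc k) x y"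
    "bump k i j = (\<lambda>t. 2 ^ k * torus_fun z (Suc k) t)"
proof
  let ?z = "\<lambda>l i' j'. of_bool (l = k \<and> i' mod 2 ^ k = i \<and> j' mod 2 ^ k = j) :: real"
  show "periodic_coeffs ?z" by (auto simp: periodic_coeffs_def)
  show "bounded_coeffs ?z" by (auto simp: bounded_coeffs_def)
  show *: "tent_cell k i x * tent_cell k j y = 2 ^ k * pot ?z (Suc k) x y" for x y
    by (simp add: pot_def tent_cell_def)
  show "bump k i j = (\<lambda>t. 2 ^ k * torus_fun ?z (Suc k) t)"
    by (simp add: fun_eq_iff bump_def torus_fun_def *)
qed

lemma bump_measurable [measurable]: "bump k i j \<in> borel_measurable borel"
  by (rule bump_eq_torus_fun[of k i j])
     (auto intro!: borel_measurable_continuous_onI continuous_intros torus_fun_continuous)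

lemma bump_proj: "bump k i j (torus_proj x) = tent_cell k i (x $ 1) * tent_cell k j (x $ 2)"
  by (rule bump_eq_torus_fun[of k i j]) (simp add: torus_fun_proj)

lemma tent_cell_nonneg: "0 \<le> tent_cell k i u"
  by (simp add: tent_cell_def tent_nonneg)

lemma tent_cell_le_half: "tent_cell k i u \<le> 1 / 2"
  using tent_le_half[of "2 ^ k * u"] by (simp add: tent_cell_def)

lemma bump_nonneg: "0 \<le> bump k i j t"
  by (simp add: bump_def tent_cell_nonneg)

lemma bump_le: "bump k i j t \<le> 1 / 4"
  unfolding bump_def
  using mult_mono[OF tent_cell_le_half tent_cell_le_half] tent_cell_nonneg by fastforce

text \<open>At each level only the square containing the point modulo the lattice contributes, so
  the double sum collapses to one term.\<close>

lemma torus_fun_eq_sum: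
  assumes "periodic_coeffs z"
  shows "torus_fun z K t =
    (\<Sum>k<K. (\<Sum>i\<in>{0..<2 ^ k}. \<Sum>j\<in>{0..<2 ^ k}. z k i j * bump k i j t) / 2 ^ k)"
  unfolding torus_fun_def pot_def
proof (rule sum.cong[OF refl])
  fix k
  let ?x = "rep_torus t $ 1" and ?y = "rep_torus t $ 2"
  let ?a = "\<lfloor>2 ^ k * ?x\<rfloor>" and ?b = "\<lfloor>2 ^ k * ?y\<rfloor>"
  have "z k ((?a mod 2 ^ k) + (?a div 2 ^ k) * 2 ^ k) ((?b mod 2 ^ k) + (?b div 2 ^ k) * 2 ^ k)
      = z k (?a mod 2 ^ k) (?b mod 2 ^ k)"
    using assms unfolding periodic_coeffs_def by blast
  then have z: "z k (?a mod 2 ^ k) (?b mod 2 ^ k) = z k ?a ?b"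
    by (simp only: mod_div_mult_eq)
  have "(\<Sum>i\<in>{0..<2 ^ k}. \<Sum>j\<in>{0..<2 ^ k}. z k i j * bump k i j t) =
    (\<Sum>i\<in>{0..<2 ^ k}. \<Sum>j\<in>{0..<2 ^ k}. if j = ?b mod 2 ^ k then (if i = ?a mod 2 ^ k then
       z k i j * tent (2 ^ k * ?x) * tent (2 ^ k * ?y) else 0) else 0)"
    by (intro sum.cong) (auto simp: bump_def tent_cell_def)
  also have "\<dots> = z k ?a ?b * tent (2 ^ k * ?x) * tent (2 ^ k * ?y)"
    by (simp add: z)
  finally show "z k ?a ?b * tent (2 ^ k * ?x) * tent (2 ^ k * ?y) / 2 ^ k =
      (\<Sum>i\<in>{0..<2 ^ k}. \<Sum>j\<in>{0..<2 ^ k}. z k i j * bump k i j t) / 2 ^ k"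
    by simp
qed

section \<open>The stopping rule and its cost\<close>

definition small_slope :: "real \<Rightarrow> coeffs \<Rightarrow> nat \<Rightarrow> int \<Rightarrow> int \<Rightarrow> bool" where
  "small_slope lam z k i j \<longleftrightarrow>
     \<bar>mean_slope z k i j\<bar> \<le> lam \<and> \<bar>mean_slope (swap z) k j i\<bar> \<le> lam"

lemma slope_cong:
  assumes "\<And>l. l < k \<Longrightarrow> z l = z' l"
  shows "slope z k i y = slope z' k i y"
  using assms by (induction k arbitrary: i) auto

lemma small_slope_cong:
  assumes "\<And>l. l < k \<Longrightarrow> z l = z' l"
  shows "small_slope lam z k i j = small_slope lam z' k i j"
proof -
  have "\<And>l. l < k \<Longrightarrow> swap z l = swap z' l"
    using assms by (simp add: swap_def fun_eq_iff)
  then show ?thesis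
    using slope_cong[of k z z'] slope_cong[of k "swap z" "swap z'"] assms
    by (simp add: small_slope_def mean_slope_def)
qed

text \<open>The coefficients at level \<open>k\<close> depend on those at lower levels only; the zero coefficients
  above level \<open>k\<close> serve to make the recursion terminate, see \<open>stopped_eq\<close>.\<close>

fun stopped :: "coeffs \<Rightarrow> real \<Rightarrow> coeffs" where
  "stopped s lam k = (\<lambda>i j.
     if small_slope lam (\<lambda>l. if l < k then stopped s lam l else (\<lambda>_ _. 0)) k i j then s k i j else 0)"

declare stopped.simps [simp del]

lemma stopped_eq:
  "stopped s lam k i j = (if small_slope lam (stopped s lam) k i j then s k i j else 0)"
proof -
  have "small_slope lam (\<lambda>l. if l < k then stopped s lam l else (\<lambda>_ _. 0)) k i j
      = small_slope lam (stopped s lam) k i j"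
    by (rule small_slope_cong) simp
  then show ?thesis by (subst stopped.simps) simp
qed

lemma bounded_stopped: "bounded_coeffs s \<Longrightarrow> bounded_coeffs (stopped s lam)"
  by (simp add: bounded_coeffs_def stopped_eq)

lemma slope_periodic:
  assumes "\<And>l i j a b. l < k \<Longrightarrow> z l (i + a * 2 ^ l) (j + b * 2 ^ l) = z l i j"
  shows "slope z k (i + a * 2 ^ k) (y + of_int b) = slope z k i y"
  using assms
proof (induction k arbitrary: i)
  case (Suc k)
  have "(i + a * 2 ^ Suc k) div 2 = i div 2 + a * 2 ^ k" "sg (i + a * 2 ^ Suc k) = sg i"
    by (simp_all add: sg_def)
  then show ?case
    using Suc by (simp add: floor_dyadic_shift tent_dyadic_shift)
qed simp

lemma small_slope_periodic:
  assumes "\<And>l i j a b. l < k \<Longrightarrow> z l (i + a * 2 ^ l) (j + b * 2 ^ l) = z l i j"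
  shows "small_slope lam z k (i + a * 2 ^ k) (j + b * 2 ^ k) = small_slope lam z k i j"
proof -
  have "centre k (m + c * 2 ^ k) = centre k m + of_int c" for m c
    by (simp add: centre_def field_simps)
  moreover have "\<And>l i j a b. l < k \<Longrightarrow> swap z l (i + a * 2 ^ l) (j + b * 2 ^ l) = swap z l i j"
    using assms by (simp add: swap_def)
  ultimately show ?thesis
    using slope_periodic[of k z] slope_periodic[of k "swap z"] assms
    by (simp add: small_slope_def mean_slope_def)
qed

text \<open>Strong induction on the level: whether a square is stopped is decided by the coarser
  coefficients.\<close>

lemma periodic_stopped:
  assumes "periodic_coeffs s"
  shows "periodic_coeffs (stopped s lam)"
proof -
  have "stopped s lam k (i + a * 2 ^ k) (j + b * 2 ^ k) = stopped s lam k i j" for k i j a b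
  proof (induction k arbitrary: i j a b rule: less_induct)
    case (less k)
    have "small_slope lam (stopped s lam) k (i + a * 2 ^ k) (j + b * 2 ^ k)
        = small_slope lam (stopped s lam) k i j"
      by (rule small_slope_periodic) (rule less.IH)
    moreover have "s k (i + a * 2 ^ k) (j + b * 2 ^ k) = s k i j"
      using assms by (simp add: periodic_coeffs_def)
    ultimately show ?case
      by (simp only: stopped_eq[of s lam k])
  qed
  then show ?thesis by (simp add: periodic_coeffs_def)
qed

text \<open>A zero coefficient leaves the slope unchanged. At a nonzero one the averaged slope is at
  most \<open>lam\<close>; the actual slope differs from it by at most 1/2, and the new term adds at
  most 1/2.\<close>

lemma slope_le_of_small_mean:
  assumes "bounded_coeffs z" "0 \<le> lam"
    and "\<And>k i j. z k i j \<noteq> 0 \<Longrightarrow> \<bar>mean_slope z k i j\<bar> \<le> lam"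
  shows "\<bar>slope z k i y\<bar> \<le> lam + 1"
proof (induction k arbitrary: i)
  case 0
  then show ?case using assms(2) by simp
next
  case (Suc k)
  let ?z = "z k (i div 2) \<lfloor>2 ^ k * y\<rfloor>"
  show ?case
  proof (cases "?z = 0")
    case True
    then show ?thesis using Suc by simp
  next
    case False
    have "\<bar>?z * sg i * tent (2 ^ k * y)\<bar> \<le> 1 / 2"
      by (rule abs_tent_increment_le[OF assms(1)])
    moreover have "\<bar>slope z k (i div 2) y - mean_slope z k (i div 2) \<lfloor>2 ^ k * y\<rfloor>\<bar> \<le> 1 / 2"
      by (intro slope_near_mean_slope assms cell_floor)
    ultimately show ?thesis using assms(3)[OF False] unfolding slope.simps by linarith
  qed
qed

text \<open>Chebyshev's inequality, with the mean square bound used once for each component of the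
  gradient.\<close>

lemma sum_not_small_slope_le:
  assumes "bounded_coeffs z" "0 < lam"
  shows "(\<Sum>i\<in>{0..<2 ^ k}. \<Sum>j\<in>{0..<2 ^ k}. of_bool (\<not> small_slope lam z k i j))
    \<le> 4 ^ k * real k / (4 * lam\<^sup>2)"
proof -
  let ?m = "mean_slope z k" and ?m' = "mean_slope (swap z) k"
  have "of_bool (\<not> small_slope lam z k i j) \<le> ((?m i j)\<^sup>2 + (?m' j i)\<^sup>2) / lam\<^sup>2" for i j
  proof (cases "small_slope lam z k i j")
    case False
    then have "lam \<le> \<bar>?m i j\<bar> \<or> lam \<le> \<bar>?m' j i\<bar>" by (auto simp: small_slope_def)
    then have "lam\<^sup>2 \<le> (?m i j)\<^sup>2 \<or> lam\<^sup>2 \<le> (?m' j i)\<^sup>2"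
      using assms(2) by (metis abs_ge_self abs_le_square_iff abs_of_pos)
    then have "lam\<^sup>2 \<le> (?m i j)\<^sup>2 + (?m' j i)\<^sup>2"
      using zero_le_power2[of "?m i j"] zero_le_power2[of "?m' j i"] by linarith
    then show ?thesis using assms(2) False by simp
  qed simp
  then have "(\<Sum>i\<in>{0..<2 ^ k}. \<Sum>j\<in>{0..<2 ^ k}. of_bool (\<not> small_slope lam z k i j))
    \<le> (\<Sum>i\<in>{0..<2 ^ k}. \<Sum>j\<in>{0..<2 ^ k}. ((?m i j)\<^sup>2 + (?m' j i)\<^sup>2) / lam\<^sup>2)"
    by (intro sum_mono)
  also have "\<dots> = ((\<Sum>i\<in>{0..<2 ^ k}. \<Sum>j\<in>{0..<2 ^ k}. (?m i j)\<^sup>2)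
      + (\<Sum>i\<in>{0..<2 ^ k}. \<Sum>j\<in>{0..<2 ^ k}. (?m' j i)\<^sup>2)) / lam\<^sup>2"
    by (simp add: sum.distrib sum_divide_distrib add_divide_distrib)
  also have "(\<Sum>i\<in>{0..<2 ^ k}. \<Sum>j\<in>{0..<2 ^ k}. (?m' j i)\<^sup>2)
      = (\<Sum>j\<in>{0..<2 ^ k}. \<Sum>i\<in>{0..<2 ^ k}. (?m' j i)\<^sup>2)"
    by (rule sum.swap)
  also have "((\<Sum>i\<in>{0..<2 ^ k}. \<Sum>j\<in>{0..<2 ^ k}. (?m i j)\<^sup>2) + \<dots>) / lam\<^sup>2
      \<le> (4 ^ k * real k / 8 + 4 ^ k * real k / 8) / lam\<^sup>2"
    by (intro divide_right_mono add_mono sum_mean_slope_sq assms bounded_coeffs_swap) auto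
  also have "\<dots> = 4 ^ k * real k / (4 * lam\<^sup>2)" by (simp add: field_simps)
  finally show ?thesis .
qed

subsection \<open>Duality\<close>

lemma ennreal_integral_le_nn_integral:
  assumes "integrable M g"
  shows "ennreal (\<integral>x. g x \<partial>M) \<le> (\<integral>\<^sup>+ x. ennreal (g x) \<partial>M)"
proof -
  have "ennreal (\<integral>x. g x \<partial>M) \<le> ennreal (\<integral>x. max 0 (g x) \<partial>M)"
    using assms by (intro ennreal_leI integral_mono) auto
  also have "\<dots> = (\<integral>\<^sup>+ x. ennreal (max 0 (g x)) \<partial>M)"
    using assms by (intro nn_integral_eq_integral[symmetric]) auto
  also have "\<dots> = (\<integral>\<^sup>+ x. ennreal (g x) \<partial>M)"
    by (intro nn_integral_cong) (simp add: max_def ennreal_neg)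
  finally show ?thesis .
qed

text \<open>The easy half of Kantorovich-Rubinstein duality: under every coupling the difference of
  integrals is the mean of \<open>f (fst p) - f (snd p)\<close>.\<close>

lemma W1_ge_lipschitz_integral_diff:
  fixes f :: "'a::metric_space \<Rightarrow> real"
  assumes C: "0 < C" and lip: "\<And>s t. \<bar>f s - f t\<bar> \<le> C * dist s t" and B: "\<And>s. \<bar>f s\<bar> \<le> B"
  shows "ennreal (((\<integral>x. f x \<partial>\<mu>) - (\<integral>x. f x \<partial>\<nu>)) / C) \<le> W1 \<mu> \<nu>"
  unfolding W1_def
proof (rule INF_greatest)
  fix \<Sigma> assume "\<Sigma> \<in> couplings \<mu> \<nu>"
  then have sets [measurable_cong]: "sets \<Sigma> = sets borel" and "prob_space \<Sigma>"
    and mu: "\<mu> = distr \<Sigma> borel fst" and nu: "\<nu> = distr \<Sigma> borel snd"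
    by (auto simp: couplings_def)
  interpret prob_space \<Sigma> by fact
  have "C-lipschitz_on UNIV f"
    using C lip by (intro lipschitz_onI) (auto simp: dist_real_def)
  then have [measurable]: "f \<in> borel_measurable borel"
    by (intro borel_measurable_continuous_onI lipschitz_on_continuous_on)
  have [measurable]: "fst \<in> \<Sigma> \<rightarrow>\<^sub>M (borel :: 'a measure)" "snd \<in> \<Sigma> \<rightarrow>\<^sub>M (borel :: 'a measure)"
    unfolding measurable_cong_sets[OF sets refl]
    by (intro borel_measurable_continuous_onI continuous_intros)+
  have int: "integrable \<Sigma> (\<lambda>p. f (fst p))" "integrable \<Sigma> (\<lambda>p. f (snd p))"
    by (rule integrable_const_bound[where B = B]; use B in auto)+
  have "((\<integral>x. f x \<partial>\<mu>) - (\<integral>x. f x \<partial>\<nu>)) / C = (\<integral>p. (f (fst p) - f (snd p)) / C \<partial>\<Sigma>)"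
    unfolding mu nu using int by (simp add: integral_distr)
  also have "ennreal \<dots> \<le> (\<integral>\<^sup>+ p. ennreal ((f (fst p) - f (snd p)) / C) \<partial>\<Sigma>)"
    using int by (intro ennreal_integral_le_nn_integral) auto
  also have "\<dots> \<le> (\<integral>\<^sup>+ p. ennreal (dist (fst p) (snd p)) \<partial>\<Sigma>)"
  proof (intro nn_integral_mono ennreal_leI)
    fix p :: "'a \<times> 'a"
    show "(f (fst p) - f (snd p)) / C \<le> dist (fst p) (snd p)"
      using lip[of "fst p" "snd p"] C by (simp add: field_simps)
  qed
  finally show "ennreal (((\<integral>x. f x \<partial>\<mu>) - (\<integral>x. f x \<partial>\<nu>)) / C)
    \<le> (\<integral>\<^sup>+ p. ennreal (dist (fst p) (snd p)) \<partial>\<Sigma>)" .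
qed

lemma W1_dyadic_lower_bound:
  fixes \<mu> \<nu> :: "torus measure"
  assumes prob: "prob_space \<mu>" "prob_space \<nu>" and sets: "sets \<mu> = sets borel" "sets \<nu> = sets borel"
    and lam: "0 < lam"
    and D: "\<And>k i j. D k i j = (\<integral>t. bump k i j t \<partial>\<mu>) - (\<integral>t. bump k i j t \<partial>\<nu>)"
  obtains I :: coeffs where "\<And>k i j. I k i j \<in> {0, 1}"
    and "\<And>k. (\<Sum>i\<in>{0..<2 ^ k}. \<Sum>j\<in>{0..<2 ^ k}. I k i j) \<le> 4 ^ k * real k / (4 * lam\<^sup>2)"
    and "ennreal ((\<Sum>k\<in>{k0..<K}. (\<Sum>i\<in>{0..<2 ^ k}. \<Sum>j\<in>{0..<2 ^ k}.
            (1 - I k i j) * \<bar>D k i j\<bar>) / 2 ^ k) / (2 * (lam + 1))) \<le> W1 \<mu> \<nu>"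
proof -
  \<comment> \<open>Reducing the indices modulo \<open>2 ^ k\<close> makes the signs periodic.
    Levels below \<open>k0\<close> are suppressed, as the variance bound used later starts at level
    4.\<close>
  define s :: coeffs where
    "s k i j = (if k0 \<le> k then sgn (D k (i mod 2 ^ k) (j mod 2 ^ k)) else 0)" for k i j
  define z where "z = stopped s lam"
  define I :: coeffs where "I k i j = of_bool (\<not> small_slope lam z k i j)" for k i j
  have per: "periodic_coeffs z" and bdd: "bounded_coeffs z"
    unfolding z_def
    by (rule periodic_stopped bounded_stopped, simp add: s_def periodic_coeffs_def bounded_coeffs_def abs_sgn_eq)+
  have small: "small_slope lam z k i j" if "z k i j \<noteq> 0" for k i j
    using that unfolding z_def by (subst (asm) stopped_eq) (auto split: if_splits)
  have slopes: "\<bar>slope z k i y\<bar> \<le> lam + 1" "\<bar>slope (swap z) k i y\<bar> \<le> lam + 1" for k i y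
    using small lam bdd bounded_coeffs_swap[OF bdd]
    by (auto intro!: slope_le_of_small_mean simp: small_slope_def swap_def[of z])
  interpret \<mu>: prob_space \<mu> by fact
  interpret \<nu>: prob_space \<nu> by fact
  note [measurable_cong] = sets
  have int: "integrable \<mu> (bump k i j)" "integrable \<nu> (bump k i j)" for k i j
    by (rule \<mu>.integrable_const_bound[where B = "1 / 4"], use bump_nonneg bump_le in auto)
       (rule \<nu>.integrable_const_bound[where B = "1 / 4"], use bump_nonneg bump_le in auto)
  let ?f = "torus_fun z K"
  \<comment> \<open>A square that is not stopped carries the sign of its discrepancy and so
    contributes the modulus.\<close>
  have zD: "z k i j * D k i j = (if k0 \<le> k then (1 - I k i j) * \<bar>D k i j\<bar> else 0)"
    if "i \<in> {0..<2 ^ k}" "j \<in> {0..<2 ^ k}" for k i j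
    using that unfolding I_def z_def by (subst stopped_eq) (auto simp: s_def abs_sgn mult.commute)
  have "(\<integral>t. ?f t \<partial>\<mu>) - (\<integral>t. ?f t \<partial>\<nu>) =
      (\<Sum>k<K. (\<Sum>i\<in>{0..<2 ^ k}. \<Sum>j\<in>{0..<2 ^ k}. z k i j * D k i j) / 2 ^ k)"
    using int by (simp add: torus_fun_eq_sum[OF per] D right_diff_distrib sum_subtractf diff_divide_distrib)
  also have "\<dots> = (\<Sum>k<K. if k0 \<le> k then (\<Sum>i\<in>{0..<2 ^ k}. \<Sum>j\<in>{0..<2 ^ k}.
            (1 - I k i j) * \<bar>D k i j\<bar>) / 2 ^ k else 0)"
    by (intro sum.cong refl) (simp add: zD)
  also have "\<dots> = (\<Sum>k\<in>{k0..<K}. (\<Sum>i\<in>{0..<2 ^ k}. \<Sum>j\<in>{0..<2 ^ k}.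
            (1 - I k i j) * \<bar>D k i j\<bar>) / 2 ^ k)"
    by (intro sum.mono_neutral_cong_right) auto
  finally have eq: "(\<integral>t. ?f t \<partial>\<mu>) - (\<integral>t. ?f t \<partial>\<nu>) = \<dots>" .
  have "ennreal (((\<integral>t. ?f t \<partial>\<mu>) - (\<integral>t. ?f t \<partial>\<nu>)) / (2 * (lam + 1))) \<le> W1 \<mu> \<nu>"
    using lam
    by (intro W1_ge_lipschitz_integral_diff[where B = "real K"] torus_fun_lipschitz abs_torus_fun_le per bdd slopes) auto
  then show thesis
    using sum_not_small_slope_le[OF bdd lam]
    by (intro that[of I]) (auto simp: eq I_def)
qed

subsection \<open>Moments\<close>

lemma (in prob_space) expectation_mult_powers:
  fixes U V :: "'a \<Rightarrow> real"
  assumes indep: "indep_var borel U borel V" and "\<And>\<omega>. \<bar>U \<omega>\<bar> \<le> a" "\<And>\<omega>. \<bar>V \<omega>\<bar> \<le> b"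
  shows "expectation (\<lambda>\<omega>. U \<omega> ^ p * V \<omega> ^ q) = expectation (\<lambda>\<omega>. U \<omega> ^ p) * expectation (\<lambda>\<omega>. V \<omega> ^ q)"
proof (rule indep_var_lebesgue_integral)
  have [measurable]: "random_variable borel U" "random_variable borel V"
    using indep_var_rv1[OF indep] indep_var_rv2[OF indep] by auto
  show "indep_var borel (\<lambda>\<omega>. U \<omega> ^ p) borel (\<lambda>\<omega>. V \<omega> ^ q)"
    using indep_var_compose[OF indep, of "\<lambda>x. x ^ p" borel "\<lambda>x. x ^ q" borel] by (simp add: comp_def)
  show "integrable M (\<lambda>\<omega>. U \<omega> ^ p)"
    using power_mono[OF assms(2)] by (intro integrable_const_bound[where B = "a ^ p"]) (auto simp: power_abs)
  show "integrable M (\<lambda>\<omega>. V \<omega> ^ q)"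
    using power_mono[OF assms(3)] by (intro integrable_const_bound[where B = "b ^ q"]) (auto simp: power_abs)
qed

lemma binomial_fourth_power:
  fixes a b :: "'a::comm_ring_1"
  shows "(a + b) ^ 4 = a ^ 4 + 4 * (a ^ 3 * b ^ 1) + 6 * (a ^ 2 * b ^ 2) + 4 * (a ^ 1 * b ^ 3) + b ^ 4"
  by (simp add: eval_nat_numeral algebra_simps)

text \<open>Induction on the index set, splitting off one summand \<open>U\<close> from the rest
  \<open>S\<close>. Both are centred and independent, so products with a first power have mean zero;
  \<open>\<bar>U\<bar> \<le> 1\<close> bounds the fourth moment of \<open>U\<close> by its
  variance.\<close>

lemma (in prob_space) sum_moments:
  fixes \<xi> :: "'j \<Rightarrow> 'a \<Rightarrow> real"
  assumes "finite J" "indep_vars (\<lambda>_. borel) \<xi> J"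
    and bound: "\<And>j \<omega>. \<bar>\<xi> j \<omega>\<bar> \<le> 1"
    and mean: "\<And>j. j \<in> J \<Longrightarrow> expectation (\<xi> j) = 0"
    and var: "\<And>j. j \<in> J \<Longrightarrow> expectation (\<lambda>\<omega>. (\<xi> j \<omega>)\<^sup>2) = v"
  shows "expectation (\<lambda>\<omega>. \<Sum>j\<in>J. \<xi> j \<omega>) = 0
    \<and> expectation (\<lambda>\<omega>. (\<Sum>j\<in>J. \<xi> j \<omega>)\<^sup>2) = real (card J) * v
    \<and> expectation (\<lambda>\<omega>. (\<Sum>j\<in>J. \<xi> j \<omega>) ^ 4) \<le> real (card J) * v + 3 * (real (card J) * v)\<^sup>2"
  using assms(1,2) mean var
proof (induction J rule: finite_induct)
  case empty
  then show ?case by simp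
next
  case (insert i J)
  define S where "S \<omega> = (\<Sum>j\<in>J. \<xi> j \<omega>)" for \<omega>
  define U where "U = \<xi> i"
  have indep: "indep_var borel U borel S"
    unfolding U_def S_def using indep_vars_sum[OF insert.hyps insert.prems(1)] by simp
  have U: "\<bar>U \<omega>\<bar> \<le> 1" for \<omega> by (simp add: U_def bound)
  have S: "\<bar>S \<omega>\<bar> \<le> real (card J)" for \<omega>
    unfolding S_def using order_trans[OF sum_abs sum_mono[of J _ "\<lambda>_. 1"]] bound by fastforce
  have [measurable]: "random_variable borel U" "random_variable borel S"
    using indep_var_rv1[OF indep] indep_var_rv2[OF indep] by auto
  have int: "integrable M (\<lambda>\<omega>. U \<omega> ^ p * S \<omega> ^ q)" for p q
  proof (rule integrable_const_bound[where B = "1 ^ p * real (card J) ^ q"])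
    have "\<bar>U \<omega>\<bar> ^ p * \<bar>S \<omega>\<bar> ^ q \<le> 1 ^ p * real (card J) ^ q" for \<omega>
      by (intro mult_mono power_mono U S) auto
    then show "AE \<omega> in M. norm (U \<omega> ^ p * S \<omega> ^ q) \<le> 1 ^ p * real (card J) ^ q"
      by (simp add: abs_mult power_abs)
  qed simp
  note intU = int[of _ 0, simplified] and intS = int[of 0, simplified]
  note prod = expectation_mult_powers[OF indep U S]
  have IH: "expectation S = 0" "expectation (\<lambda>\<omega>. (S \<omega>)\<^sup>2) = real (card J) * v"
    "expectation (\<lambda>\<omega>. S \<omega> ^ 4) \<le> real (card J) * v + 3 * (real (card J) * v)\<^sup>2"
    using insert.IH indep_vars_subset[OF insert.prems(1)] insert.prems(2,3)
    unfolding S_def by auto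
  have EU: "expectation U = 0" "expectation (\<lambda>\<omega>. (U \<omega>)\<^sup>2) = v"
    unfolding U_def using insert.prems by auto
  have "expectation (\<lambda>\<omega>. U \<omega> ^ 4) \<le> expectation (\<lambda>\<omega>. (U \<omega>)\<^sup>2)"
  proof (intro integral_mono intU)
    fix \<omega>
    have "\<bar>U \<omega>\<bar> ^ 4 \<le> \<bar>U \<omega>\<bar>\<^sup>2" using U by (intro power_decreasing) auto
    then show "U \<omega> ^ 4 \<le> (U \<omega>)\<^sup>2" by simp
  qed
  then have EU4: "expectation (\<lambda>\<omega>. U \<omega> ^ 4) \<le> v" using EU by simp
  have sum: "(\<Sum>j\<in>insert i J. \<xi> j \<omega>) = U \<omega> + S \<omega>" for \<omega>
    using insert.hyps by (simp add: U_def S_def)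
  have card: "real (card (insert i J)) = real (card J) + 1"
    using insert.hyps by simp
  have 1: "expectation (\<lambda>\<omega>. U \<omega> + S \<omega>) = 0"
    using EU IH intU[of 1] intS[of 1] by simp
  have "(\<lambda>\<omega>. (U \<omega> + S \<omega>)\<^sup>2) = (\<lambda>\<omega>. (U \<omega>)\<^sup>2 + 2 * (U \<omega> ^ 1 * S \<omega> ^ 1) + (S \<omega>)\<^sup>2)"
    by (simp add: fun_eq_iff power2_eq_square algebra_simps)
  then have "expectation (\<lambda>\<omega>. (U \<omega> + S \<omega>)\<^sup>2) = expectation (\<lambda>\<omega>. (U \<omega>)\<^sup>2)
      + 2 * expectation (\<lambda>\<omega>. U \<omega> ^ 1 * S \<omega> ^ 1) + expectation (\<lambda>\<omega>. (S \<omega>)\<^sup>2)"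
    by (simp only:) (simp only: Bochner_Integration.integral_add integral_mult_right_zero
      Bochner_Integration.integrable_add integrable_mult_right int intU intS)
  then have 2: "expectation (\<lambda>\<omega>. (U \<omega> + S \<omega>)\<^sup>2) = (real (card J) + 1) * v"
    unfolding prod by (simp add: EU IH algebra_simps)
  have "(\<lambda>\<omega>. (U \<omega> + S \<omega>) ^ 4) = (\<lambda>\<omega>. U \<omega> ^ 4 + 4 * (U \<omega> ^ 3 * S \<omega> ^ 1) + 6 * (U \<omega> ^ 2 * S \<omega> ^ 2)
      + 4 * (U \<omega> ^ 1 * S \<omega> ^ 3) + S \<omega> ^ 4)"
    by (simp only: binomial_fourth_power)
  then have "expectation (\<lambda>\<omega>. (U \<omega> + S \<omega>) ^ 4) = expectation (\<lambda>\<omega>. U \<omega> ^ 4)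
      + 4 * expectation (\<lambda>\<omega>. U \<omega> ^ 3 * S \<omega> ^ 1) + 6 * expectation (\<lambda>\<omega>. U \<omega> ^ 2 * S \<omega> ^ 2)
      + 4 * expectation (\<lambda>\<omega>. U \<omega> ^ 1 * S \<omega> ^ 3) + expectation (\<lambda>\<omega>. S \<omega> ^ 4)"
    by (simp only:) (simp only: Bochner_Integration.integral_add integral_mult_right_zero
      Bochner_Integration.integrable_add integrable_mult_right int intU intS)
  also have "\<dots> \<le> v + 6 * (v * (real (card J) * v)) + (real (card J) * v + 3 * (real (card J) * v)\<^sup>2)"
    unfolding prod using EU4 IH EU by simp
  \<comment> \<open>The increase of the squared term is \<open>6 * card J * v * v\<close> plus a
    nonnegative rest, which absorbs the mixed term.\<close>
  also have "\<dots> \<le> (real (card J) + 1) * v + 3 * ((real (card J) + 1) * v)\<^sup>2"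
    by (simp add: power2_eq_square algebra_simps)
  finally show ?case unfolding sum card using 1 2 by blast
qed

section \<open>Moments of bumps under the uniform measure\<close>

definition rect :: "real \<Rightarrow> real \<Rightarrow> real \<Rightarrow> real \<Rightarrow> (real^2) set" where
  "rect a b c d = {x. x $ 1 \<in> {a..b} \<and> x $ 2 \<in> {c..d}}"

lemma rect_eq_cbox: "rect a b c d = cbox (vector [a, c]) (vector [b, d])"
  by (auto simp: rect_def mem_box_cart forall_2)

abbreviation unit_square_measure :: "(real^2) measure" where
  "unit_square_measure \<equiv> uniform_measure lborel (cbox 0 1)"

lemma emeasure_unit_square: "emeasure lborel (cbox 0 1 :: (real^2) set) = 1"
  by (subst emeasure_lborel_cbox) (auto simp: Basis_vec_def inner_axis prod.neutral)

lemma measure_rect: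
  assumes "0 \<le> a" "a \<le> b" "b \<le> 1" "0 \<le> c" "c \<le> d" "d \<le> 1"
  shows "measure unit_square_measure (rect a b c d) = (b - a) * (d - c)"
proof -
  have sub: "cbox 0 1 \<inter> rect a b c d = rect a b c d"
    using assms by (auto simp: rect_def mem_box_cart forall_2)
  have ne: "vector [a, c] \<in> rect a b c d" using assms by (simp add: rect_def)
  have "measure unit_square_measure (rect a b c d)
      = measure lborel (cbox 0 1 \<inter> rect a b c d) / measure lborel (cbox 0 1 :: (real^2) set)"
    by (rule measure_uniform_measure) (simp_all add: emeasure_unit_square rect_eq_cbox)
  also have "measure lborel (cbox 0 1 :: (real^2) set) = 1"
    by (simp add: measure_def emeasure_unit_square)
  also have "measure lborel (cbox 0 1 \<inter> rect a b c d) = (b - a) * (d - c)"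
    unfolding sub using ne unfolding rect_eq_cbox
    by (subst content_cbox_cart) (auto simp: UNIV_2)
  finally show ?thesis by simp
qed

lemma rect_sets [measurable]: "rect a b c d \<in> sets borel"
  by (simp add: rect_eq_cbox)

lemma tent_cell_eq_0:
  assumes "0 \<le> x" "x \<le> 1" "x \<notin> cell k i"
  shows "tent_cell k i x = 0"
proof (cases "x = 1")
  case True
  \<comment> \<open>At \<open>x = 1\<close> the index wraps around to cell 0, but the tent vanishes
    there.\<close>
  have "tent (2 ^ k * x) = 0" using tent_of_int[of "2 ^ k"] True by simp
  then show ?thesis by (simp add: tent_cell_def)
next
  case False
  then have "2 ^ k * x < 2 ^ k" "0 \<le> 2 ^ k * x" using assms by auto
  then have "\<lfloor>2 ^ k * x\<rfloor> < 2 ^ k" "0 \<le> \<lfloor>2 ^ k * x\<rfloor>" by (simp_all add: floor_less_iff)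
  then have "\<lfloor>2 ^ k * x\<rfloor> mod 2 ^ k = \<lfloor>2 ^ k * x\<rfloor>" by simp
  then show ?thesis using assms(3) cell_floor[of x k] by (auto simp: tent_cell_def)
qed

lemma tent_cell_ge_quarter:
  assumes "i \<in> {0..<2 ^ k}" "(of_int i + 1 / 4) / 2 ^ k \<le> x" "x \<le> (of_int i + 3 / 4) / 2 ^ k"
  shows "1 / 4 \<le> tent_cell k i x"
proof -
  have x: "of_int i + 1 / 4 \<le> 2 ^ k * x" "2 ^ k * x \<le> of_int i + 3 / 4"
    using assms by (simp_all add: field_simps)
  then have "\<lfloor>2 ^ k * x\<rfloor> = i" by linarith
  then show ?thesis using x assms(1) by (simp add: tent_cell_def tent_def frac_def)
qed

lemma integral_torus_measure:
  fixes f :: "torus \<Rightarrow> real"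
  assumes [measurable]: "f \<in> borel_measurable borel"
  shows "(\<integral>t. f t \<partial>torus_measure) = (\<integral>x. f (torus_proj x) \<partial>unit_square_measure)"
  unfolding torus_measure_def by (rule integral_distr) auto

text \<open>Above: within the unit square the bump is at most 1/4 and vanishes off a square of area
  \<open>1 / 4 ^ k\<close>; \<open>0 < p\<close> matters because \<open>0 ^ 0 = 1\<close>. Below: on
  the concentric square of half the side both tents are at least 1/4.\<close>

lemma bump_moment_bounds:
  assumes ij: "i \<in> {0..<2 ^ k}" "j \<in> {0..<2 ^ k}"
  shows "0 < p \<Longrightarrow> (\<integral>t. bump k i j t ^ p \<partial>torus_measure) \<le> (1 / 4) ^ p / 4 ^ k"
    and "(1 / 16) ^ p / 4 / 4 ^ k \<le> (\<integral>t. bump k i j t ^ p \<partial>torus_measure)"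
proof -
  interpret prob_space unit_square_measure
    by (rule prob_space_uniform_measure) (simp_all add: emeasure_unit_square)
  let ?g = "\<lambda>x. bump k i j (torus_proj x) ^ p"
  have eq: "(\<integral>t. bump k i j t ^ p \<partial>torus_measure) = (\<integral>x. ?g x \<partial>unit_square_measure)"
    by (rule integral_torus_measure) simp
  have int: "integrable unit_square_measure ?g"
    by (rule integrable_const_bound[where B = "(1 / 4) ^ p"])
       (use bump_nonneg bump_le in \<open>auto intro!: power_mono simp: power_abs\<close>)
  have AE: "AE x in unit_square_measure. x \<in> cbox 0 1"
    by (rule AE_uniform_measureI) auto
  have i: "0 \<le> real_of_int i" "real_of_int i + 1 \<le> 2 ^ k" "0 \<le> real_of_int j" "real_of_int j + 1 \<le> 2 ^ k"
  proof -
    have "i + 1 \<le> 2 ^ k" "j + 1 \<le> 2 ^ k" using ij by auto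
    then have "real_of_int (i + 1) \<le> real_of_int (2 ^ k)" "real_of_int (j + 1) \<le> real_of_int (2 ^ k)"
      by (simp_all only: of_int_le_iff)
    then show "0 \<le> real_of_int i" "real_of_int i + 1 \<le> 2 ^ k" "0 \<le> real_of_int j" "real_of_int j + 1 \<le> 2 ^ k"
      using ij by simp_all
  qed
  have pow: "(2 ^ k * 2 ^ k :: real) = 4 ^ k"
    using power_mult_distrib[of "2 :: real" 2 k] by simp
  show "(\<integral>t. bump k i j t ^ p \<partial>torus_measure) \<le> (1 / 4) ^ p / 4 ^ k" if "0 < p"
  proof -
    let ?R = "rect (of_int i / 2 ^ k) ((of_int i + 1) / 2 ^ k) (of_int j / 2 ^ k) ((of_int j + 1) / 2 ^ k)"
    have "(\<integral>x. ?g x \<partial>unit_square_measure) \<le> (\<integral>x. indicator ?R x *\<^sub>R (1 / 4) ^ p \<partial>unit_square_measure)"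
    proof (rule integral_mono_AE[OF int])
      show "AE x in unit_square_measure. ?g x \<le> indicator ?R x *\<^sub>R (1 / 4) ^ p"
        using AE
      proof eventually_elim
        case (elim x)
        show ?case
        proof (cases "x \<in> ?R")
          case True
          then show ?thesis using bump_nonneg bump_le by (auto intro!: power_mono)
        next
          case False
          then have "tent_cell k i (x $ 1) = 0 \<or> tent_cell k j (x $ 2) = 0"
            using tent_cell_eq_0[of "x $ 1" k i] tent_cell_eq_0[of "x $ 2" k j] elim
            by (auto simp: rect_def cell_def mem_box_cart forall_2)
          then show ?thesis using False that by (auto simp: bump_proj power_0_left)
        qed
      qed
    qed (rule integrable_const_bound[where B = "(1 / 4) ^ p"], auto split: split_indicator)
    also have "\<dots> = measure unit_square_measure ?R * (1 / 4) ^ p"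
      by simp
    also have "measure unit_square_measure ?R = 1 / 4 ^ k"
      using i by (subst measure_rect) (simp_all add: field_simps pow)
    finally show ?thesis by (simp add: eq)
  qed
  show "(1 / 16) ^ p / 4 / 4 ^ k \<le> (\<integral>t. bump k i j t ^ p \<partial>torus_measure)"
  proof -
    let ?R = "rect ((of_int i + 1 / 4) / 2 ^ k) ((of_int i + 3 / 4) / 2 ^ k)
      ((of_int j + 1 / 4) / 2 ^ k) ((of_int j + 3 / 4) / 2 ^ k)"
    have "measure unit_square_measure ?R = 1 / 4 / 4 ^ k"
      using i by (subst measure_rect) (simp_all add: field_simps pow)
    then have "(1 / 16 :: real) ^ p / 4 / 4 ^ k = (\<integral>x. indicator ?R x *\<^sub>R (1 / 16) ^ p \<partial>unit_square_measure)"
      by simp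
    also have "\<dots> \<le> (\<integral>x. ?g x \<partial>unit_square_measure)"
    proof (rule integral_mono[OF _ int])
      fix x
      show "indicator ?R x *\<^sub>R (1 / 16) ^ p \<le> ?g x"
      proof (cases "x \<in> ?R")
        case True
        then have "1 / 4 * (1 / 4) \<le> bump k i j (torus_proj x)"
          unfolding bump_proj using ij
          by (intro mult_mono tent_cell_ge_quarter) (auto simp: rect_def tent_cell_nonneg)
        then show ?thesis using True by (auto intro!: power_mono)
      qed (simp add: bump_nonneg)
    qed (rule integrable_const_bound[where B = "(1 / 16) ^ p"], auto split: split_indicator)
    finally show ?thesis by (simp add: eq)
  qed
qed

section \<open>Empirical measures and the variance of a bump\<close>

lemma empirical_measure_eq_distr:
  assumes "0 < n"
  shows "empirical_measure n x = distr (measure_pmf (pmf_of_set {..<n})) borel x"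
proof (rule measure_eqI)
  fix A assume "A \<in> sets (empirical_measure n x)"
  then have A: "A \<in> sets borel" by simp
  have fin: "finite {..<n}" "{..<n} \<noteq> {}" using assms by auto
  have "(\<Sum>i<n. emeasure (return borel (x i)) A) = (\<Sum>i<n. ennreal (indicator A (x i)))"
    using A by (simp add: ennreal_indicator)
  also have "\<dots> = ennreal (\<Sum>i<n. indicator A (x i))"
    by (rule sum_ennreal) simp
  also have "(\<Sum>i<n. indicator A (x i) :: real) = real (card ({..<n} \<inter> x -` A))"
    by (simp add: indicator_def sum.If_cases vimage_def Int_def)
  finally show "emeasure (empirical_measure n x) A = emeasure (distr (measure_pmf (pmf_of_set {..<n})) borel x) A"
    using A assms
    by (simp add: emeasure_empirical_measure emeasure_distr emeasure_pmf_of_set[OF fin(2,1)]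
        ennreal_mult[symmetric])
qed simp

lemma prob_space_empirical_measure: "0 < n \<Longrightarrow> prob_space (empirical_measure n x)"
  unfolding empirical_measure_eq_distr
  by (rule prob_space.prob_space_distr) (auto intro: prob_space_measure_pmf)

lemma integral_empirical_measure:
  fixes f :: "'a::topological_space \<Rightarrow> real"
  assumes "0 < n" and [measurable]: "f \<in> borel_measurable borel"
  shows "(\<integral>t. f t \<partial>empirical_measure n x) = (\<Sum>i<n. f (x i)) / real n"
proof -
  have fin: "finite {..<n}" "{..<n} \<noteq> {}" using assms by auto
  show ?thesis
    unfolding empirical_measure_eq_distr[OF assms(1)]
    by (subst integral_distr) (auto simp: integral_pmf_of_set[OF fin(2,1)])
qed

lemma integrable_bump_power: "integrable torus_measure (\<lambda>t. bump k i j t ^ p)"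
proof -
  interpret prob_space torus_measure by (rule prob_space_torus_measure)
  have [measurable_cong]: "sets torus_measure = sets borel" by (simp add: torus_measure_def)
  have "bump k i j t ^ p \<le> (1 / 4) ^ p" for t
    using bump_nonneg bump_le by (intro power_mono)
  then show ?thesis
    by (intro integrable_const_bound[where B = "(1 / 4) ^ p"]) (auto simp: bump_nonneg)
qed

lemma bump_torus_variance_bounds:
  fixes i j :: int
  assumes ij: "i \<in> {0..<2 ^ k}" "j \<in> {0..<2 ^ k}" and k: "4 \<le> k"
  defines "m \<equiv> \<integral>t. bump k i j t \<partial>torus_measure"
  shows "(\<integral>t. (bump k i j t - m)\<^sup>2 \<partial>torus_measure) \<in> {1 / 4 ^ k / 2048 .. 1 / 4 ^ k / 16}"
proof -
  interpret prob_space torus_measure by (rule prob_space_torus_measure)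
  have int: "integrable torus_measure (bump k i j)" "integrable torus_measure (\<lambda>t. (bump k i j t)\<^sup>2)"
    using integrable_bump_power[of k i j 1] integrable_bump_power[of k i j 2] by simp_all
  have v: "(\<integral>t. (bump k i j t - m)\<^sup>2 \<partial>torus_measure) = (\<integral>t. (bump k i j t)\<^sup>2 \<partial>torus_measure) - m\<^sup>2"
    unfolding m_def by (rule variance_eq[OF int])
  have "0 \<le> m" unfolding m_def by (simp add: bump_nonneg)
  moreover have "m \<le> 1 / 4 / 4 ^ k"
    using bump_moment_bounds(1)[OF ij, of 1] by (simp add: m_def)
  ultimately have "m\<^sup>2 \<le> (1 / 4 / 4 ^ k)\<^sup>2" by (intro power_mono)
  also have "\<dots> = (1 / 4 ^ k) * (1 / 4 ^ k) / 16" by (simp add: power2_eq_square)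
  \<comment> \<open>From level 4 on the squared mean is at most a quarter of the lower bound for the
    second moment.\<close>
  also have "\<dots> \<le> (1 / 4 ^ k) * (1 / 4 ^ 4) / 16"
    by (intro divide_right_mono mult_left_mono divide_left_mono power_increasing k) auto
  finally have "m\<^sup>2 \<le> 1 / 4 ^ k / 4096" by simp
  moreover have "1 / 4 ^ k / 1024 \<le> (\<integral>t. (bump k i j t)\<^sup>2 \<partial>torus_measure)"
    "(\<integral>t. (bump k i j t)\<^sup>2 \<partial>torus_measure) \<le> 1 / 4 ^ k / 16"
    using bump_moment_bounds[OF ij, of 2] by (simp_all add: power2_eq_square)
  moreover define a :: real where "a = 1 / 4 ^ k"
  ultimately show ?thesis
    unfolding v atLeastAtMost_iff a_def[symmetric] using zero_le_power2[of m] by linarith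
qed

subsection \<open>The expected distance\<close>

text \<open>A lower bound whose random part is polynomial in \<open>d\<close>, while the stopping indicator \<open>b\<close> enters
  only through a term that is bounded deterministically after summation: neither measurability of
  \<open>b\<close> nor its dependence on \<open>d\<close> matters.\<close>

lemma truncated_abs_ge_polynomial:
  fixes d s b :: real
  assumes "0 < s" "b \<in> {0, 1}"
  shows "d\<^sup>2 / s - d ^ 4 / s ^ 3 - s * b / 4 \<le> (1 - b) * \<bar>d\<bar>"
proof -
  define t where "t = \<bar>d\<bar> / s"
  have t: "0 \<le> t" using assms by (simp add: t_def)
  have d: "\<bar>d\<bar> = t * s" using assms by (simp add: t_def)
  have "d\<^sup>2 = (t * s)\<^sup>2" "d ^ 4 = (t * s) ^ 4"
    by (simp_all flip: d)
  then have "d\<^sup>2 / s - d ^ 4 / s ^ 3 = s * (t\<^sup>2 - t ^ 4)"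
    using assms by (simp add: field_simps eval_nat_numeral)
  \<comment> \<open>This bound settles \<open>b = 1\<close>; the bound by \<open>t\<close> below
    settles \<open>b = 0\<close>.\<close>
  moreover have "t\<^sup>2 - t ^ 4 \<le> 1 / 4"
  proof -
    have "0 \<le> (t\<^sup>2 - 1 / 2)\<^sup>2" by simp
    then show ?thesis by (simp add: eval_nat_numeral algebra_simps)
  qed
  moreover have "t\<^sup>2 - t ^ 4 \<le> t"
  proof (cases "t \<le> 1")
    case True
    then have "t\<^sup>2 \<le> t" using t by (simp add: power2_eq_square mult_left_le)
    then show ?thesis using zero_le_power[OF t, of 4] by linarith
  next
    case False
    then have "t\<^sup>2 \<le> t ^ 4" by (intro power_increasing) auto
    then show ?thesis using t by linarith
  qed
  ultimately show ?thesis
    using assms unfolding d by (auto simp: mult.commute[of t])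
qed

text \<open>Both matching problems are covered through the choice of \<open>J\<close>: the signs \<open>e\<close> are \<open>1\<close> for the points
  of the first sample and \<open>-1\<close> for those of the second sample, if there is one.\<close>

lemma (in prob_space) expected_W1_lower_bound:
  fixes Z :: "'j \<Rightarrow> 'a \<Rightarrow> torus" and e :: "'j \<Rightarrow> real" and \<mu> \<nu> :: "'a \<Rightarrow> torus measure"
  assumes J: "finite J" "n \<le> card J" "card J \<le> 2 * n"
    and indep: "indep_vars (\<lambda>_. borel) Z J"
    and law: "\<And>l. l \<in> J \<Longrightarrow> distr M borel (Z l) = torus_measure"
    and e: "\<And>l. \<bar>e l\<bar> = 1"
    and K: "0 < K" "2048 * 4 ^ K \<le> real n"
    and prob: "\<And>\<omega>. prob_space (\<mu> \<omega>)" "\<And>\<omega>. prob_space (\<nu> \<omega>)"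
    and sets: "\<And>\<omega>. sets (\<mu> \<omega>) = sets borel" "\<And>\<omega>. sets (\<nu> \<omega>) = sets borel"
    and rel: "\<And>\<omega> k i j. real n * ((\<integral>t. bump k i j t \<partial>\<mu> \<omega>) - (\<integral>t. bump k i j t \<partial>\<nu> \<omega>)) =
      (\<Sum>l\<in>J. e l * (bump k i j (Z l \<omega>) - (\<integral>t. bump k i j t \<partial>torus_measure)))"
  shows "ennreal ((real K - 4) / (16384 * (32 * sqrt (real K) + 1) * sqrt (real n)))
    \<le> (\<integral>\<^sup>+ \<omega>. W1 (\<mu> \<omega>) (\<nu> \<omega>) \<partial>M)"
proof -
  \<comment> \<open>With this threshold at most a fraction \<open>k / (4096 * K)\<close>, below
    1/4096, of the squares of a level \<open>k < K\<close> is stopped.\<close>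
  define lam where "lam = 32 * sqrt (real K)"
  have lam: "0 < lam" "lam\<^sup>2 = 1024 * real K" using K by (simp_all add: lam_def power_mult_distrib)
  have n: "0 < real n" using K(2) by (smt (verit) zero_less_power)
  \<comment> \<open>The order of the standard deviation of the unnormalised discrepancy
    \<open>D k i j\<close>.\<close>
  define s where "s k = sqrt (real n) / 2 ^ k" for k :: nat
  have s_pos: "0 < s k" for k using n by (simp add: s_def)
  have s_sq: "(s k)\<^sup>2 = real n / 4 ^ k" for k
    using n by (simp add: s_def power_divide power2_eq_square flip: power_mult_distrib)
  define \<xi> where "\<xi> k i j l \<omega> =
    e l * (bump k i j (Z l \<omega>) - (\<integral>t. bump k i j t \<partial>torus_measure))" for k i j l \<omega>
  define D where "D k i j \<omega> = (\<Sum>l\<in>J. \<xi> k i j l \<omega>)" for k i j \<omega>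
  define Q where "Q k i j \<omega> = (D k i j \<omega>)\<^sup>2 / s k - D k i j \<omega> ^ 4 / s k ^ 3" for k i j \<omega>
  \<comment> \<open>An integrable minorant of the distance. The subtracted term is the loss by
    stopping: at most \<open>4 ^ k / 4096\<close> squares, at a cost of \<open>s k / 4\<close>
    each.\<close>
  define G where "G \<omega> = (\<Sum>k\<in>{4..<K}. ((\<Sum>i\<in>{0..<2 ^ k}. \<Sum>j\<in>{0..<2 ^ k}. Q k i j \<omega>)
      - s k * 4 ^ k / 16384) / 2 ^ k) / (2 * (lam + 1) * real n)" for \<omega>

  have Z_rv: "random_variable borel (Z l)" if "l \<in> J" for l
    using indep that by (simp add: indep_vars_def)
  have mean_bounds: "0 \<le> (\<integral>t. bump k i j t \<partial>torus_measure)" "(\<integral>t. bump k i j t \<partial>torus_measure) \<le> 1 / 4" for k i j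
  proof -
    interpret T: prob_space torus_measure by (rule prob_space_torus_measure)
    have "integrable torus_measure (bump k i j)"
      using integrable_bump_power[of k i j 1] by simp
    then show "(\<integral>t. bump k i j t \<partial>torus_measure) \<le> 1 / 4"
      by (rule T.integral_le_const) (simp add: bump_le[simplified])
    show "0 \<le> (\<integral>t. bump k i j t \<partial>torus_measure)" by (simp add: bump_nonneg)
  qed
  have \<xi>_le: "\<bar>\<xi> k i j l \<omega>\<bar> \<le> 1" for k i j l \<omega>
  proof -
    have "\<bar>bump k i j (Z l \<omega>) - (\<integral>t. bump k i j t \<partial>torus_measure)\<bar> \<le> 1"
      using mean_bounds[of k i j] bump_nonneg[of k i j "Z l \<omega>"] bump_le[of k i j "Z l \<omega>"] by linarith
    then show ?thesis by (simp add: \<xi>_def abs_mult e)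
  qed
  have \<xi>_rv: "random_variable borel (\<xi> k i j l)" if "l \<in> J" for k i j l
    unfolding \<xi>_def using Z_rv[OF that] by measurable
  have D_rv [measurable]: "random_variable borel (D k i j)" for k i j
    unfolding D_def using \<xi>_rv by measurable
  have D_le: "\<bar>D k i j \<omega>\<bar> \<le> real (card J)" for k i j \<omega>
    unfolding D_def using order_trans[OF sum_abs sum_mono[of J _ "\<lambda>_. 1"]] \<xi>_le by fastforce
  have D_int: "integrable M (\<lambda>\<omega>. D k i j \<omega> ^ p)" for k i j p
    using power_mono[OF D_le]
    by (intro integrable_const_bound[where B = "real (card J) ^ p"]) (auto simp: power_abs)

  have EQ: "s k / 4096 \<le> expectation (Q k i j)"
    if k: "4 \<le> k" "k < K" and ij: "i \<in> {0..<2 ^ k}" "j \<in> {0..<2 ^ k}" for k i j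
  proof -
    let ?m = "\<integral>t. bump k i j t \<partial>torus_measure"
    define v where "v = (\<integral>t. (bump k i j t - ?m)\<^sup>2 \<partial>torus_measure)"
    have v: "1 / 4 ^ k / 2048 \<le> v" "v \<le> 1 / 4 ^ k / 16"
      using bump_torus_variance_bounds[OF ij k(1)] by (simp_all add: v_def)
    have "indep_vars (\<lambda>_. borel) (\<lambda>l \<omega>. (\<lambda>l t. e l * (bump k i j t - ?m)) l (Z l \<omega>)) J"
      by (rule indep_vars_compose2[OF indep]) simp
    then have "indep_vars (\<lambda>_. borel) (\<xi> k i j) J"
      by (simp add: \<xi>_def[abs_def])
    moreover have "expectation (\<xi> k i j l) = 0" if "l \<in> J" for l
    proof -
      interpret T: prob_space torus_measure by (rule prob_space_torus_measure)
      have int: "integrable torus_measure (bump k i j)"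
        using integrable_bump_power[of k i j 1] by simp
      have "expectation (\<xi> k i j l) = (\<integral>t. e l * (bump k i j t - ?m) \<partial>distr M borel (Z l))"
        unfolding \<xi>_def using Z_rv[OF that] by (simp add: integral_distr)
      also have "\<dots> = e l * ((\<integral>t. bump k i j t \<partial>torus_measure) - ?m)"
        unfolding law[OF that] using int by (simp add: T.prob_space)
      finally show ?thesis by simp
    qed
    moreover have "expectation (\<lambda>\<omega>. (\<xi> k i j l \<omega>)\<^sup>2) = v" if "l \<in> J" for l
    proof -
      have "expectation (\<lambda>\<omega>. (\<xi> k i j l \<omega>)\<^sup>2) = expectation (\<lambda>\<omega>. (bump k i j (Z l \<omega>) - ?m)\<^sup>2)"
        unfolding \<xi>_def power_mult_distrib using e[of l] by (simp add: abs_square_eq_1)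
      also have "\<dots> = (\<integral>t. (bump k i j t - ?m)\<^sup>2 \<partial>distr M borel (Z l))"
        using Z_rv[OF that] by (simp add: integral_distr)
      finally show ?thesis unfolding law[OF that] v_def .
    qed
    ultimately have "expectation (D k i j) = 0
      \<and> expectation (\<lambda>\<omega>. (D k i j \<omega>)\<^sup>2) = real (card J) * v
      \<and> expectation (\<lambda>\<omega>. D k i j \<omega> ^ 4) \<le> real (card J) * v + 3 * (real (card J) * v)\<^sup>2"
      unfolding D_def by (intro sum_moments J(1) \<xi>_le)
    then have ED: "expectation (\<lambda>\<omega>. (D k i j \<omega>)\<^sup>2) = real (card J) * v"
      "expectation (\<lambda>\<omega>. D k i j \<omega> ^ 4) \<le> real (card J) * v + 3 * (real (card J) * v)\<^sup>2"
      by blast+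
    define x where "x = real (card J) * v"
    have "real n * (1 / 4 ^ k / 2048) \<le> x"
      unfolding x_def using J v by (intro mult_mono) auto
    then have x_ge: "(s k)\<^sup>2 / 2048 \<le> x" by (simp add: s_sq)
    have "x \<le> (2 * real n) * (1 / 4 ^ k / 16)"
      unfolding x_def using J v(2) order_trans[OF _ v(1), of 0] by (intro mult_mono) auto
    then have x_le: "x \<le> (s k)\<^sup>2 / 8" by (simp add: s_sq)
    \<comment> \<open>Squares are large enough for the variance \<open>x\<close> to be at least 1,
      so the linear term of the fourth moment is dominated by \<open>x\<^sup>2\<close>.\<close>
    have "2048 * 4 ^ k \<le> real n"
      by (rule order_trans[OF mult_left_mono[OF power_increasing] K(2)]) (use k in auto)
    then have "2048 \<le> (s k)\<^sup>2" by (simp add: s_sq field_simps)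
    then have x1: "1 \<le> x" using x_ge by simp
    have "x * 1 \<le> x * x" using x1 by (intro mult_left_mono) auto
    then have D4: "expectation (\<lambda>\<omega>. D k i j \<omega> ^ 4) \<le> 4 * x\<^sup>2"
      using ED(2) unfolding x_def[symmetric] by (simp add: power2_eq_square)
    have "s k / 4096 = (s k)\<^sup>2 / 2048 / (2 * s k)" using s_pos[of k] by (simp add: power2_eq_square)
    also have "\<dots> \<le> x / (2 * s k)"
      using x_ge s_pos[of k] by (intro divide_right_mono) auto
    \<comment> \<open>Since \<open>x\<close> is at most \<open>(s k)\<^sup>2 / 8\<close>, the
      quartic correction takes away at most half of the main term \<open>x / s k\<close>.\<close>
    also have "\<dots> = x / s k - 4 * x * ((s k)\<^sup>2 / 8) / s k ^ 3"
      using s_pos[of k] by (simp add: field_simps eval_nat_numeral)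
    also have "\<dots> \<le> x / s k - 4 * x * x / s k ^ 3"
      using x_le x1 s_pos[of k] by (intro diff_left_mono divide_right_mono mult_left_mono) auto
    also have "\<dots> \<le> x / s k - expectation (\<lambda>\<omega>. D k i j \<omega> ^ 4) / s k ^ 3"
      using D4 s_pos[of k] by (intro diff_left_mono divide_right_mono) (auto simp: power2_eq_square)
    also have "\<dots> = expectation (Q k i j)"
      unfolding Q_def x_def by (simp add: D_int ED(1))
    finally show ?thesis .
  qed

  have Q_int: "integrable M (Q k i j)" for k i j
    unfolding Q_def by (simp add: D_int)
  have G_int: "integrable M G"
    unfolding G_def by (simp add: Q_int)

  \<comment> \<open>The indicators \<open>I\<close> are chosen separately for each sample point and
    are eliminated before any expectation is taken.\<close>
  have G_le: "ennreal (G \<omega>) \<le> W1 (\<mu> \<omega>) (\<nu> \<omega>)" for \<omega>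
  proof -
    obtain I where I: "\<And>k i j. I k i j \<in> {0, 1}"
      and cnt: "\<And>k. (\<Sum>i\<in>{0..<2 ^ k}. \<Sum>j\<in>{0..<2 ^ k}. I k i j) \<le> 4 ^ k * real k / (4 * lam\<^sup>2)"
      and W: "ennreal ((\<Sum>k\<in>{4..<K}. (\<Sum>i\<in>{0..<2 ^ k}. \<Sum>j\<in>{0..<2 ^ k}.
            (1 - I k i j) * \<bar>D k i j \<omega> / real n\<bar>) / 2 ^ k) / (2 * (lam + 1))) \<le> W1 (\<mu> \<omega>) (\<nu> \<omega>)"
    proof (rule W1_dyadic_lower_bound[OF prob(1)[of \<omega>] prob(2)[of \<omega>] sets(1) sets(2) lam(1),
          of "\<lambda>k i j. D k i j \<omega> / real n" 4 K])
      show "D k i j \<omega> / real n = (\<integral>t. bump k i j t \<partial>\<mu> \<omega>) - (\<integral>t. bump k i j t \<partial>\<nu> \<omega>)" for k i j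
        using rel[of \<omega> k i j] n by (simp add: D_def \<xi>_def field_simps)
    qed blast
    have level: "(\<Sum>i\<in>{0..<2 ^ k}. \<Sum>j\<in>{0..<2 ^ k}. Q k i j \<omega>) - s k * 4 ^ k / 16384
        \<le> (\<Sum>i\<in>{0..<2 ^ k}. \<Sum>j\<in>{0..<2 ^ k}. (1 - I k i j) * \<bar>D k i j \<omega>\<bar>)"
      if "k < K" for k
    proof -
      have "(\<Sum>i\<in>{0..<2 ^ k}. \<Sum>j\<in>{0..<2 ^ k}. I k i j) \<le> 4 ^ k * real k / (4 * lam\<^sup>2)"
        by (rule cnt)
      also have "\<dots> \<le> 4 ^ k / 4096"
        using that by (simp add: lam(2) field_simps)
      finally have "s k / 4 * (\<Sum>i\<in>{0..<2 ^ k}. \<Sum>j\<in>{0..<2 ^ k}. I k i j) \<le> s k / 4 * (4 ^ k / 4096)"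
        using s_pos[of k] by (intro mult_left_mono) auto
      then have "(\<Sum>i\<in>{0..<2 ^ k}. \<Sum>j\<in>{0..<2 ^ k}. Q k i j \<omega>) - s k * 4 ^ k / 16384
        \<le> (\<Sum>i\<in>{0..<2 ^ k}. \<Sum>j\<in>{0..<2 ^ k}. Q k i j \<omega>)
          - s k / 4 * (\<Sum>i\<in>{0..<2 ^ k}. \<Sum>j\<in>{0..<2 ^ k}. I k i j)"
        by simp
      also have "\<dots> = (\<Sum>i\<in>{0..<2 ^ k}. \<Sum>j\<in>{0..<2 ^ k}. Q k i j \<omega> - s k * I k i j / 4)"
        by (simp add: sum_subtractf sum_distrib_left)
      also have "\<dots> \<le> (\<Sum>i\<in>{0..<2 ^ k}. \<Sum>j\<in>{0..<2 ^ k}. (1 - I k i j) * \<bar>D k i j \<omega>\<bar>)"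
        unfolding Q_def by (intro sum_mono truncated_abs_ge_polynomial s_pos I)
      finally show ?thesis .
    qed
    have "G \<omega> \<le> (\<Sum>k\<in>{4..<K}. (\<Sum>i\<in>{0..<2 ^ k}. \<Sum>j\<in>{0..<2 ^ k}.
            (1 - I k i j) * \<bar>D k i j \<omega>\<bar>) / 2 ^ k) / (2 * (lam + 1) * real n)"
      unfolding G_def using lam(1) n level by (intro divide_right_mono sum_mono) auto
    also have "\<dots> = (\<Sum>k\<in>{4..<K}. (\<Sum>i\<in>{0..<2 ^ k}. \<Sum>j\<in>{0..<2 ^ k}.
            (1 - I k i j) * \<bar>D k i j \<omega> / real n\<bar>) / 2 ^ k) / (2 * (lam + 1))"
      using n by (simp add: abs_divide sum_divide_distrib field_simps)
    finally show ?thesis using W ennreal_leI order_trans by blast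
  qed

  have "(real K - 4) / (16384 * (32 * sqrt (real K) + 1) * sqrt (real n))
      \<le> real (K - 4) * (sqrt (real n) / 8192) / (2 * (lam + 1) * real n)"
  proof -
    have "real (K - 4) * (sqrt (real n) / 8192) / (2 * (lam + 1) * real n)
        = real (K - 4) / (16384 * (lam + 1) * sqrt (real n))"
    proof -
      have "a * (q / 8192) / (2 * (lam + 1) * (q * q)) = a / (16384 * (lam + 1) * q)" if "0 < q" for a q
        using that lam(1) by (simp add: divide_simps)
      from this[of "sqrt (real n)" "real (K - 4)"] show ?thesis using n by simp
    qed
    moreover have "real K - 4 \<le> real (K - 4)" by simp
    ultimately show ?thesis
      using n lam(1) unfolding lam_def[symmetric] by (auto intro!: divide_right_mono)
  qed
  also have "\<dots> = (\<Sum>k\<in>{4..<K}. sqrt (real n) / 8192) / (2 * (lam + 1) * real n)"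
    by simp
  also have "\<dots> \<le> (\<Sum>k\<in>{4..<K}. ((\<Sum>i\<in>{0..<2 ^ k}. \<Sum>j\<in>{0..<2 ^ k}. expectation (Q k i j))
      - s k * 4 ^ k / 16384) / 2 ^ k) / (2 * (lam + 1) * real n)"
  proof (intro divide_right_mono sum_mono)
    fix k assume k: "k \<in> {4..<K}"
    have pow: "(4 :: real) ^ k = 2 ^ k * 2 ^ k" using power_mult_distrib[of "2 :: real" 2 k] by simp
    have "4 ^ k * (s k / 4096) = (\<Sum>i\<in>{0..<2 ^ k :: int}. \<Sum>j\<in>{0..<2 ^ k :: int}. s k / 4096)"
      by (simp add: pow)
    also have "\<dots> \<le> (\<Sum>i\<in>{0..<2 ^ k}. \<Sum>j\<in>{0..<2 ^ k}. expectation (Q k i j))"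
      using k by (intro sum_mono EQ) auto
    finally have "(4 ^ k * (s k / 4096) - s k * 4 ^ k / 16384) / 2 ^ k
      \<le> ((\<Sum>i\<in>{0..<2 ^ k}. \<Sum>j\<in>{0..<2 ^ k}. expectation (Q k i j)) - s k * 4 ^ k / 16384) / 2 ^ k"
      by (intro divide_right_mono diff_right_mono) simp_all
    \<comment> \<open>As \<open>s k * 4 ^ k / 2 ^ k = sqrt n\<close>, every level contributes the
      same amount; the sum over levels yields the factor \<open>K - 4\<close>.\<close>
    moreover have "(4 ^ k * (s k / 4096) - s k * 4 ^ k / 16384) / 2 ^ k = 3 / 16384 * sqrt (real n)"
      unfolding s_def pow by (simp add: field_simps)
    moreover have "sqrt (real n) / 8192 \<le> 3 / 16384 * sqrt (real n)" by simp
    ultimately show "sqrt (real n) / 8192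
      \<le> ((\<Sum>i\<in>{0..<2 ^ k}. \<Sum>j\<in>{0..<2 ^ k}. expectation (Q k i j)) - s k * 4 ^ k / 16384) / 2 ^ k"
      by linarith
  qed (use lam(1) in auto)
  also have "\<dots> = expectation G"
    unfolding G_def by (simp add: Q_int prob_space)
  finally have "ennreal ((real K - 4) / (16384 * (32 * sqrt (real K) + 1) * sqrt (real n)))
      \<le> ennreal (expectation G)" by (rule ennreal_leI)
  also have "\<dots> \<le> (\<integral>\<^sup>+ \<omega>. ennreal (G \<omega>) \<partial>M)"
    by (rule ennreal_integral_le_nn_integral[OF G_int])
  also have "\<dots> \<le> (\<integral>\<^sup>+ \<omega>. W1 (\<mu> \<omega>) (\<nu> \<omega>) \<partial>M)"
    by (intro nn_integral_mono G_le)
  finally show ?thesis .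
qed

section \<open>Choice of the number of scales and conclusion\<close>

lemma liminf_sqrt_log_scaling:
  fixes w :: "nat \<Rightarrow> ennreal"
  assumes bound: "\<And>n K. 0 < K \<Longrightarrow> 2048 * 4 ^ K \<le> real n \<Longrightarrow>
    ennreal ((real K - 4) / (16384 * (32 * sqrt (real K) + 1) * sqrt (real n))) \<le> w n"
  shows "liminf (\<lambda>n. ennreal (sqrt (real n / ln (real n))) * w n) > 0"
proof -
  \<comment> \<open>The losses are 33 from \<open>32 * r + 1 \<le> 33 * r\<close>, 2 from
    \<open>K - 4 \<ge> K / 2\<close>, and 4 from \<open>sqrt L \<le> 4 * sqrt K\<close>. The
    threshold \<open>exp 36\<close> gives \<open>K \<ge> 8\<close>.\<close>
  define c :: real where "c = 1 / (8 * 16384 * 33)"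
  have "ennreal c \<le> ennreal (sqrt (real n / ln (real n))) * w n" if "nat \<lceil>exp 36 :: real\<rceil> \<le> n" for n
  proof -
    have en: "exp 36 \<le> real n" using that by linarith
    then have n: "0 < real n" using exp_gt_zero[of "36 :: real"] by linarith
    define L where "L = ln (real n)"
    have L: "36 \<le> L" using en n by (simp add: L_def ln_ge_iff)
    have expL: "exp L = real n" using n by (simp add: L_def)
    \<comment> \<open>Then \<open>4 ^ K\<close> is at most \<open>exp (L / 2) = sqrt n\<close>, and
      the other factor \<open>sqrt n\<close> absorbs 2048.\<close>
    define K where "K = nat \<lfloor>L / 4\<rfloor>"
    have K_le: "real K \<le> L / 4" and K_ge: "L / 4 - 1 \<le> real K"
      using L unfolding K_def by linarith+
    have K8: "8 \<le> real K" using K_ge L by simp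
    have e1: "(2 :: real) \<le> exp 1" using exp_ge_add_one_self[of 1] by simp
    have "(4 :: real) ^ K \<le> (exp 1 * exp 1) ^ K"
      using mult_mono[OF e1 e1] by (intro power_mono) auto
    also have "\<dots> = exp (2 * real K)" by (simp add: power_mult_distrib exp_double power2_eq_square flip: exp_of_nat_mult)
    also have "\<dots> \<le> exp (L / 2)" using K_le by simp
    finally have p4: "(4 :: real) ^ K \<le> exp (L / 2)" .
    have "(2048 :: real) = 2 ^ 11" by simp
    also have "\<dots> \<le> exp 1 ^ 11" using e1 by (intro power_mono) auto
    also have "\<dots> = exp 11" by (simp flip: exp_of_nat_mult)
    also have "\<dots> \<le> exp (L / 2)" using L by simp
    finally have "2048 * 4 ^ K \<le> exp (L / 2) * exp (L / 2)" using p4 by (intro mult_mono) auto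
    also have "\<dots> = real n" by (simp add: expL flip: exp_add)
    finally have w: "ennreal ((real K - 4) / (16384 * (32 * sqrt (real K) + 1) * sqrt (real n))) \<le> w n"
      using K8 by (intro bound) auto
    define r where "r = sqrt (real K)"
    define q where "q = sqrt L"
    have r: "1 \<le> r" "real K = r * r" using K8 by (simp_all add: r_def)
    have q: "0 < q" "L = q * q" using L by (simp_all add: q_def)
    have "q = 4 * sqrt (L / 16)" by (simp add: q_def real_sqrt_divide)
    also have "\<dots> \<le> 4 * r" unfolding r_def using K_ge L by simp
    finally have qr: "q \<le> 4 * r" .
    have "c = r / (16384 * 33 * 2 * (4 * r))" using r by (simp add: c_def)
    also have "\<dots> \<le> r / (16384 * 33 * 2 * q)"
      using qr q r by (intro divide_left_mono mult_left_mono mult_pos_pos) auto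
    also have "\<dots> = (r * r / 2) / (16384 * (33 * r) * q)" using r by (simp add: field_simps)
    also have "\<dots> \<le> (real K - 4) / (16384 * (32 * r + 1) * q)"
      using K8 r q by (intro frac_le mult_mono mult_pos_pos) auto
    also have "\<dots> = sqrt (real n / L) * ((real K - 4) / (16384 * (32 * r + 1) * sqrt (real n)))"
      using n L by (simp add: real_sqrt_divide q_def)
    finally have "ennreal c \<le> ennreal (sqrt (real n / L) * ((real K - 4) / (16384 * (32 * r + 1) * sqrt (real n))))"
      by (rule ennreal_leI)
    also have "\<dots> = ennreal (sqrt (real n / L)) * ennreal ((real K - 4) / (16384 * (32 * r + 1) * sqrt (real n)))"
      using n L K8 r by (intro ennreal_mult) auto
    also have "\<dots> \<le> ennreal (sqrt (real n / L)) * w n"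
      using w unfolding r_def by (intro mult_left_mono) auto
    finally show ?thesis by (simp add: L_def)
  qed
  then have "\<forall>\<^sub>F n in sequentially. ennreal c \<le> ennreal (sqrt (real n / ln (real n))) * w n"
    unfolding eventually_sequentially by blast
  then have "ennreal c \<le> liminf (\<lambda>n. ennreal (sqrt (real n / ln (real n))) * w n)"
    by (rule Liminf_bounded)
  moreover have "0 < ennreal c" by (simp add: c_def)
  ultimately show ?thesis by order
qed

theorem theorem5p2:
  fixes M :: "'a measure" and X Y :: "nat \<Rightarrow> 'a \<Rightarrow> torus"
  assumes "prob_space M"
    and "prob_space.indep_vars M (\<lambda>_. borel) (case_sum X Y) UNIV"
    and "\<And>i. distr M borel (X i) = torus_measure"
    and "\<And>i. distr M borel (Y i) = torus_measure"
  shows "liminf (\<lambda>n. ennreal (sqrt (real n / ln (real n))) *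
            (\<integral>\<^sup>+ \<omega>. W1 (empirical_measure n (\<lambda>i. X i \<omega>)) (empirical_measure n (\<lambda>i. Y i \<omega>)) \<partial>M)) > 0
       \<and> liminf (\<lambda>n. ennreal (sqrt (real n / ln (real n))) *
            (\<integral>\<^sup>+ \<omega>. W1 (empirical_measure n (\<lambda>i. X i \<omega>)) torus_measure \<partial>M)) > 0"
proof (intro conjI liminf_sqrt_log_scaling)
  interpret prob_space M by fact
  fix n K :: nat
  assume K: "0 < K" "2048 * 4 ^ K \<le> real n"
  have "(0 :: real) < 2048 * 4 ^ K" by simp
  then have n: "0 < n" using K(2) by (simp only: flip: of_nat_0_less_iff[where 'a = real])
  have indep: "indep_vars (\<lambda>_. borel) (case_sum X Y) J" for J
    by (rule indep_vars_subset[OF assms(2)]) simp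
  have law: "distr M borel (case_sum X Y l) = torus_measure" for l
    using assms(3,4) by (cases l) auto
  let ?e = "case_sum (\<lambda>_. 1) (\<lambda>_. -1) :: nat + nat \<Rightarrow> real"
  have e: "\<bar>?e l\<bar> = 1" for l by (cases l) auto
  \<comment> \<open>With two samples of equal size and opposite signs the centring integrals
    cancel.\<close>
  show "ennreal ((real K - 4) / (16384 * (32 * sqrt (real K) + 1) * sqrt (real n)))
    \<le> (\<integral>\<^sup>+ \<omega>. W1 (empirical_measure n (\<lambda>i. X i \<omega>)) (empirical_measure n (\<lambda>i. Y i \<omega>)) \<partial>M)"
    by (rule expected_W1_lower_bound[where J = "{..<n} <+> {..<n}" and e = ?e, OF _ _ _ indep law e K])
       (simp_all add: card_Plus prob_space_empirical_measure[OF n] integral_empirical_measure[OF n] sum.Plus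
          sum_subtractf sum_negf right_diff_distrib n)
  \<comment> \<open>With one sample the centring integrals add up to \<open>n\<close> times the
    integral against \<open>torus_measure\<close>.\<close>
  show "ennreal ((real K - 4) / (16384 * (32 * sqrt (real K) + 1) * sqrt (real n)))
    \<le> (\<integral>\<^sup>+ \<omega>. W1 (empirical_measure n (\<lambda>i. X i \<omega>)) torus_measure \<partial>M)"
    by (rule expected_W1_lower_bound[where J = "{..<n} <+> {}" and e = ?e, OF _ _ _ indep law e K])
       (simp_all add: card_Plus prob_space_empirical_measure[OF n] integral_empirical_measure[OF n] sum.Plus
          sum_subtractf right_diff_distrib n prob_space_torus_measure, simp add: torus_measure_def)
qed

end
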